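(* Let $G$ be a compact Hausdorff group and $X$ a complete operator space. Then: (i) If $\nu\in M(G,X)$ then $\widehat{\nu}\in\ell^\infty\text{-}\bigoplus_{[\pi]\in\widehat{G}}M_{d_\pi}(X)$. In fact, $\sup_{[\pi]\in\widehat{G}}\|\widehat{\nu}(\pi)\|_{d_\pi}\leq\|\nu\|$. (ii) The Fourier transform operator $\mathcal{F}$ from $M(G,X)$ to $\ell^\infty\text{-}\bigoplus_{[\pi]\in\widehat{G}}M_{d_\pi}(X)$ given by $\mathcal{F}(\nu)=\widehat{\nu}$ is completely bounded.
   Context: $M(G,X)$ is the space of $\sigma$-additive $X$-valued vector measures on the Borel sets of $G$, with the semivariation norm $\|\nu\|=\sup_{x'\in B_{X'}}|\langle\nu,x'\rangle|(G)$, where $B_{X'}$ is the closed unit ball of the dual $X'$, $\langle\nu,x'\rangle(A)=\langle\nu(A),x'\rangle$ and $|\cdot|$ is total variation. Its operator space structure comes from identifying $M_n(M(G,X))$ with $M(G,M_n(X))$ (semivariation norm taken for the Banach space $M_n(X)$) via $[\nu_{ij}]\mapsto\tilde\nu$, $\tilde\nu(A)=[\nu_{ij}(A)]$. $\widehat G$ is the set of classes of irreducible unitary representations $\pi$ of $G$, $d_\pi=\dim\mathcal{H}_\pi$, $\pi(t)_{ij}=\langle\pi(t)e_j^\pi,e_i^\pi\rangle$ for a fixed ordered orthonormal basis of $\mathcal{H}_\pi$. The Fourier transform of $\nu$ is $\widehat\nu(\pi)=\frac1{d_\pi}\int_G\pi(t)^*\,d\nu(t)\in M_{d_\pi}(X)$,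 the matrix with entries $\frac1{d_\pi}\int_G\overline{\pi(t)_{ji}}\,d\nu(t)\in X$. Here for a bounded Borel function $f$, $\int_Gf\,d\nu$ is the element of $X$ with $\langle\int_Gf\,d\nu,x'\rangle=\int_Gf\,d\langle\nu,x'\rangle$ for all $x'\in X'$. $\|\cdot\|_n$ on $M_n(X)$ is the operator space matrix norm of $X$. $\ell^\infty\text{-}\bigoplus_\alpha X_\alpha$ is the space of families with $\sup_\alpha\|x_\alpha\|<\infty$, with the sup norm and matrix norms $M_n(\ell^\infty\text{-}\bigoplus X_\alpha)=\ell^\infty\text{-}\bigoplus M_n(X_\alpha)$, where $M_n(M_d(X))=M_{nd}(X)$. A linear map $\varphi$ is completely bounded if its amplifications $\varphi_n([x_{ij}])=[\varphi(x_{ij})]$ satisfy $\sup_n\|\varphi_n\|<\infty$. *)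

theory Defs
  imports
    "HOL-Analysis.Bochner_Integration"
    "HOL-Library.Function_Algebras"
    "HOL-Library.Disjoint_Sets"
    "Jordan_Normal_Form.Schur_Decomposition"
    "Jordan_Normal_Form.VS_Connect"
begin

section \<open>Complex normed spaces and their duals\<close>

text \<open>A complex normed space is a carrier set inside an additive group \<open>'e\<close>, so addition and
  finite sums are those of the type (pointwise on function types, by \<open>Function_Algebras\<close>), together
  with an explicit complex scalar multiplication and an explicit norm. Values of \<open>scal\<close> and \<open>nrm\<close>
  off the carrier are irrelevant.\<close>

record 'e cnormed =
  vecs :: "'e set"
  scal :: "complex \<Rightarrow> 'e \<Rightarrow> 'e"
  nrm :: "'e \<Rightarrow> real"

locale complex_normed_space =
  fixes E :: "('e::ab_group_add, 'm) cnormed_scheme"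
  assumes zero_mem: "0 \<in> vecs E"
    and add_mem: "x \<in> vecs E \<Longrightarrow> y \<in> vecs E \<Longrightarrow> x + y \<in> vecs E"
    and scal_mem: "x \<in> vecs E \<Longrightarrow> scal E a x \<in> vecs E"
    and scal_add_right: "x \<in> vecs E \<Longrightarrow> y \<in> vecs E \<Longrightarrow> scal E a (x + y) = scal E a x + scal E a y"
    and scal_add_left: "x \<in> vecs E \<Longrightarrow> scal E (a + b) x = scal E a x + scal E b x"
    and scal_scal: "x \<in> vecs E \<Longrightarrow> scal E a (scal E b x) = scal E (a * b) x"
    and scal_one: "x \<in> vecs E \<Longrightarrow> scal E 1 x = x"
    and nrm_eq_zero: "x \<in> vecs E \<Longrightarrow> nrm E x = 0 \<longleftrightarrow> x = 0"
    and nrm_triangle: "x \<in> vecs E \<Longrightarrow> y \<in> vecs E \<Longrightarrow> nrm E (x + y) \<le> nrm E x + nrm E y"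
    and nrm_scal: "x \<in> vecs E \<Longrightarrow> nrm E (scal E a x) = cmod a * nrm E x"

definition linear_map ::
    "('e::ab_group_add, 'm) cnormed_scheme \<Rightarrow> ('f::ab_group_add, 'n) cnormed_scheme \<Rightarrow> ('e \<Rightarrow> 'f) \<Rightarrow> bool"
  where "linear_map E F \<phi> \<longleftrightarrow>
    (\<forall>x\<in>vecs E. \<phi> x \<in> vecs F) \<and>
    (\<forall>x\<in>vecs E. \<forall>y\<in>vecs E. \<phi> (x + y) = \<phi> x + \<phi> y) \<and>
    (\<forall>a. \<forall>x\<in>vecs E. \<phi> (scal E a x) = scal F a (\<phi> x))"

text \<open>The operator norm takes values in \<open>[0,\<infinity>]\<close>, so that unbounded maps get the value \<open>\<infinity>\<close>.\<close>

definition op_norm ::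
    "('e::ab_group_add, 'm) cnormed_scheme \<Rightarrow> ('f::ab_group_add, 'n) cnormed_scheme \<Rightarrow> ('e \<Rightarrow> 'f) \<Rightarrow> ennreal"
  where "op_norm E F \<phi> = (SUP x\<in>{x\<in>vecs E. nrm E x \<le> 1}. ennreal (nrm F (\<phi> x)))"

definition scalar_field :: "complex cnormed"
  where "scalar_field = \<lparr>vecs = UNIV, scal = (*), nrm = cmod\<rparr>"

definition dual :: "('e::ab_group_add, 'm) cnormed_scheme \<Rightarrow> ('e \<Rightarrow> complex) set"
  where "dual E = {f. linear_map E scalar_field f \<and> op_norm E scalar_field f < \<infinity>}"

definition dual_ball :: "('e::ab_group_add, 'm) cnormed_scheme \<Rightarrow> ('e \<Rightarrow> complex) set"
  where "dual_ball E = {f\<in>dual E. op_norm E scalar_field f \<le> 1}"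

definition complete_space :: "('e::ab_group_add, 'm) cnormed_scheme \<Rightarrow> bool"
  where "complete_space E \<longleftrightarrow>
    (\<forall>s. (\<forall>n. s n \<in> vecs E) \<and> (\<forall>\<epsilon>>0. \<exists>N. \<forall>m\<ge>N. \<forall>n\<ge>N. nrm E (s m - s n) < \<epsilon>) \<longrightarrow>
      (\<exists>x\<in>vecs E. (\<lambda>n::nat. nrm E (s n - x)) \<longlonglongrightarrow> 0))"


section \<open>Operator spaces\<close>

text \<open>An \<open>n \<times> n\<close> matrix over \<open>'e\<close> is a function of two indices \<open>i, j < n\<close> which vanishes outside
  this range; \<open>mnrm V n\<close> is the norm of \<open>M\<^sub>n(V)\<close>. Scalar matrices are those of \<open>Jordan_Normal_Form\<close>.\<close>

definition mats :: "nat \<Rightarrow> 'e::zero set \<Rightarrow> (nat \<Rightarrow> nat \<Rightarrow> 'e) set"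
  where "mats n S = {x. (\<forall>i<n. \<forall>j<n. x i j \<in> S) \<and> (\<forall>i j. \<not> (i < n \<and> j < n) \<longrightarrow> x i j = 0)}"

record 'e mnormed = "'e cnormed" +
  mnrm :: "nat \<Rightarrow> (nat \<Rightarrow> nat \<Rightarrow> 'e) \<Rightarrow> real"

definition Mat :: "nat \<Rightarrow> ('e::ab_group_add, 'm) mnormed_scheme \<Rightarrow> (nat \<Rightarrow> nat \<Rightarrow> 'e) cnormed"
  where "Mat n V = \<lparr>vecs = mats n (vecs V), scal = (\<lambda>a x i j. scal V a (x i j)), nrm = mnrm V n\<rparr>"

definition single :: "'e::zero \<Rightarrow> nat \<Rightarrow> nat \<Rightarrow> 'e"
  where "single x = (\<lambda>i j. if i = 0 \<and> j = 0 then x else 0)"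

definition direct_sum :: "nat \<Rightarrow> (nat \<Rightarrow> nat \<Rightarrow> 'e::zero) \<Rightarrow> (nat \<Rightarrow> nat \<Rightarrow> 'e) \<Rightarrow> nat \<Rightarrow> nat \<Rightarrow> 'e"
  where "direct_sum m x y = (\<lambda>i j.
    if i < m \<and> j < m then x i j else if m \<le> i \<and> m \<le> j then y (i - m) (j - m) else 0)"

text \<open>The product \<open>\<alpha> x \<beta>\<close> for \<open>\<alpha>\<close> of size \<open>m \<times> n\<close>, \<open>x\<close> in \<open>M\<^sub>n(V)\<close>, and \<open>\<beta>\<close> of size \<open>n \<times> m\<close>.\<close>

definition sandwich ::
    "('e::ab_group_add, 'm) mnormed_scheme \<Rightarrow> complex mat \<Rightarrow> (nat \<Rightarrow> nat \<Rightarrow> 'e) \<Rightarrow> complex mat \<Rightarrow> nat \<Rightarrow> nat \<Rightarrow> 'e"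
  where "sandwich V \<alpha> x \<beta> = (\<lambda>i j. if i < dim_row \<alpha> \<and> j < dim_col \<beta>
    then \<Sum>k<dim_col \<alpha>. \<Sum>l<dim_row \<beta>. scal V (\<alpha> $$ (i, k) * \<beta> $$ (l, j)) (x k l) else 0)"

definition l2norm :: "complex vec \<Rightarrow> real"
  where "l2norm v = sqrt (\<Sum>i<dim_vec v. (cmod (v $ i))\<^sup>2)"

definition scalar_mat_norm :: "complex mat \<Rightarrow> real"
  where "scalar_mat_norm \<alpha> = (SUP v\<in>{v\<in>carrier_vec (dim_col \<alpha>). l2norm v \<le> 1}. l2norm (\<alpha> *\<^sub>v v))"

text \<open>Abstract operator spaces, by Ruan's axioms.\<close>

locale operator_space = complex_normed_space V
  for V :: "('e::ab_group_add, 'm) mnormed_scheme" +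
  assumes Mat_normed: "1 \<le> n \<Longrightarrow> complex_normed_space (Mat n V)"
    and mnrm_single: "v \<in> vecs V \<Longrightarrow> mnrm V 1 (single v) = nrm V v"
    and mnrm_direct_sum: "1 \<le> m \<Longrightarrow> 1 \<le> n \<Longrightarrow> x \<in> mats m (vecs V) \<Longrightarrow> y \<in> mats n (vecs V) \<Longrightarrow>
      mnrm V (m + n) (direct_sum m x y) = max (mnrm V m x) (mnrm V n y)"
    and mnrm_sandwich: "1 \<le> m \<Longrightarrow> 1 \<le> n \<Longrightarrow> \<alpha> \<in> carrier_mat m n \<Longrightarrow> \<beta> \<in> carrier_mat n m \<Longrightarrow>
      x \<in> mats n (vecs V) \<Longrightarrow>
      mnrm V m (sandwich V \<alpha> x \<beta>) \<le> scalar_mat_norm \<alpha> * mnrm V n x * scalar_mat_norm \<beta>"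

text \<open>The matrix norms on \<open>M\<^sub>d(V)\<close>: an \<open>n \<times> n\<close> matrix of \<open>d \<times> d\<close> blocks is read as an
  \<open>nd \<times> nd\<close> matrix.\<close>

definition Mat_os :: "nat \<Rightarrow> ('e::ab_group_add, 'm) mnormed_scheme \<Rightarrow> (nat \<Rightarrow> nat \<Rightarrow> 'e) mnormed"
  where "Mat_os d V = \<lparr>vecs = vecs (Mat d V), scal = scal (Mat d V), nrm = nrm (Mat d V),
    mnrm = (\<lambda>n Z. mnrm V (n * d) (\<lambda>p q. Z (p div d) (q div d) (p mod d) (q mod d)))\<rparr>"

text \<open>Families indexed by \<open>I\<close> are functions on the index type which vanish outside \<open>I\<close>.\<close>

definition linf_sum :: "'i set \<Rightarrow> ('i \<Rightarrow> ('e::ab_group_add, 'm) mnormed_scheme) \<Rightarrow> ('i \<Rightarrow> 'e) mnormed"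
  where "linf_sum I V = \<lparr>
    vecs = {x. (\<forall>i\<in>I. x i \<in> vecs (V i)) \<and> (\<forall>i. i \<notin> I \<longrightarrow> x i = 0) \<and>
               bdd_above ((\<lambda>i. nrm (V i) (x i)) ` I)},
    scal = (\<lambda>a x i. if i \<in> I then scal (V i) a (x i) else 0),
    nrm = (\<lambda>x. SUP i\<in>I. nrm (V i) (x i)),
    mnrm = (\<lambda>n Z. SUP i\<in>I. mnrm (V i) n (\<lambda>k l. Z k l i))\<rparr>"

definition amplification ::
    "nat \<Rightarrow> ('e \<Rightarrow> 'f::zero) \<Rightarrow> (nat \<Rightarrow> nat \<Rightarrow> 'e) \<Rightarrow> nat \<Rightarrow> nat \<Rightarrow> 'f"
  where "amplification n \<phi> x = (\<lambda>i j. if i < n \<and> j < n then \<phi> (x i j) else 0)"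

definition completely_bounded ::
    "('e::ab_group_add, 'm) mnormed_scheme \<Rightarrow> ('f::ab_group_add, 'n) mnormed_scheme \<Rightarrow> ('e \<Rightarrow> 'f) \<Rightarrow> bool"
  where "completely_bounded V W \<phi> \<longleftrightarrow>
    linear_map V W \<phi> \<and> (SUP n\<in>{1..}. op_norm (Mat n V) (Mat n W) (amplification n \<phi>)) < \<infinity>"


section \<open>Vector measures\<close>

text \<open>A set function on the Borel sets is made total by the value \<open>0\<close> on the other sets.\<close>

definition vector_measures ::
    "('e::ab_group_add, 'm) cnormed_scheme \<Rightarrow> ('g::topological_space set \<Rightarrow> 'e) set"
  where "vector_measures E = {\<nu>.
    (\<forall>A\<in>sets borel. \<nu> A \<in> vecs E) \<and> (\<forall>A. A \<notin> sets borel \<longrightarrow> \<nu> A = 0) \<and>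
    (\<forall>A::nat \<Rightarrow> 'g set. range A \<subseteq> sets borel \<and> disjoint_family A \<longrightarrow>
      (\<lambda>n. nrm E ((\<Sum>i<n. \<nu> (A i)) - \<nu> (\<Union>i. A i))) \<longlonglongrightarrow> 0)}"

definition total_variation :: "('g::topological_space set \<Rightarrow> complex) \<Rightarrow> 'g set \<Rightarrow> ennreal"
  where "total_variation \<mu> A =
    (SUP P\<in>{P. finite P \<and> partition_on A P \<and> P \<subseteq> sets borel}. \<Sum>B\<in>P. ennreal (cmod (\<mu> B)))"

definition semivariation ::
    "('e::ab_group_add, 'm) cnormed_scheme \<Rightarrow> ('g::topological_space set \<Rightarrow> 'e) \<Rightarrow> ennreal"
  where "semivariation E \<nu> = (SUP f\<in>dual_ball E. total_variation (\<lambda>A. f (\<nu> A)) UNIV)"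

text \<open>The semivariation of a vector measure is finite, so \<open>enn2real\<close> loses nothing here.\<close>

definition measure_space_os ::
    "('e::ab_group_add, 'm) mnormed_scheme \<Rightarrow> ('g::topological_space set \<Rightarrow> 'e) mnormed"
  where "measure_space_os V = \<lparr>
    vecs = vector_measures V,
    scal = (\<lambda>a \<nu> A. if A \<in> sets borel then scal V a (\<nu> A) else 0),
    nrm = (\<lambda>\<nu>. enn2real (semivariation V \<nu>)),
    mnrm = (\<lambda>n N. enn2real (semivariation (Mat n V) (\<lambda>A i j. N i j A)))\<rparr>"

text \<open>The integral against a complex measure \<open>\<mu>\<close> is defined through the Jordan decompositions of
  its real and imaginary parts; \<open>upper_variation m\<close> is the positive part of the finite signed
  measure \<open>m\<close>. (The empty set contributes \<open>0\<close> to the supremum, so negative values, which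
  \<open>ennreal\<close> sends to \<open>0\<close>, play no role.)\<close>

definition upper_variation :: "('g::topological_space set \<Rightarrow> real) \<Rightarrow> 'g measure"
  where "upper_variation m =
    measure_of UNIV (sets borel) (\<lambda>A. SUP B\<in>{B\<in>sets borel. B \<subseteq> A}. ennreal (m B))"

definition complex_measure_integral ::
    "('g::topological_space set \<Rightarrow> complex) \<Rightarrow> ('g \<Rightarrow> complex) \<Rightarrow> complex"
  where "complex_measure_integral \<mu> f =
    (integral\<^sup>L (upper_variation (\<lambda>A. Re (\<mu> A))) f - integral\<^sup>L (upper_variation (\<lambda>A. - Re (\<mu> A))) f) +
    \<i> * (integral\<^sup>L (upper_variation (\<lambda>A. Im (\<mu> A))) f - integral\<^sup>L (upper_variation (\<lambda>A. - Im (\<mu> A))) f)"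

definition vector_integral ::
    "('e::ab_group_add, 'm) cnormed_scheme \<Rightarrow> ('g::topological_space set \<Rightarrow> 'e) \<Rightarrow> ('g \<Rightarrow> complex) \<Rightarrow> 'e"
  where "vector_integral E \<nu> f =
    (THE x. x \<in> vecs E \<and> (\<forall>x'\<in>dual E. x' x = complex_measure_integral (\<lambda>A. x' (\<nu> A)) f))"


section \<open>Representations and the Fourier transform\<close>

text \<open>Groups are written additively, since that is how the library provides topological groups as
  a type class; \<open>group_add\<close> is not commutative. A unitary representation on a finite-dimensional
  Hilbert space with a fixed ordered orthonormal basis is a matrix-valued map, and changing the
  basis is a unitary equivalence. Irreducible unitary representations of compact groups are
  finite-dimensional, so these matrix representations account for all classes.\<close>

definition unitary_mat :: "nat \<Rightarrow> complex mat \<Rightarrow> bool"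
  where "unitary_mat d U \<longleftrightarrow> U \<in> carrier_mat d d \<and> mat_adjoint U * U = 1\<^sub>m d \<and> U * mat_adjoint U = 1\<^sub>m d"

definition unitary_rep :: "nat \<Rightarrow> ('g::topological_group_add \<Rightarrow> complex mat) \<Rightarrow> bool"
  where "unitary_rep d \<pi> \<longleftrightarrow>
    (\<forall>t. unitary_mat d (\<pi> t)) \<and> (\<forall>s t. \<pi> (s + t) = \<pi> s * \<pi> t) \<and>
    (\<forall>i<d. \<forall>j<d. continuous_on UNIV (\<lambda>t. \<pi> t $$ (i, j)))"

definition irreducible_rep :: "nat \<Rightarrow> ('g::topological_group_add \<Rightarrow> complex mat) \<Rightarrow> bool"
  where "irreducible_rep d \<pi> \<longleftrightarrow> 0 < d \<and> unitary_rep d \<pi> \<and>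
    (\<forall>W. subspace class_ring W (module_vec TYPE(complex) d) \<and> (\<forall>t. \<forall>w\<in>W. \<pi> t *\<^sub>v w \<in> W) \<longrightarrow>
      W = {0\<^sub>v d} \<or> W = carrier_vec d)"

definition irreps :: "('g::topological_group_add \<Rightarrow> complex mat) set"
  where "irreps = {\<pi>. \<exists>d. irreducible_rep d \<pi>}"

definition rep_dim :: "('g::topological_group_add \<Rightarrow> complex mat) \<Rightarrow> nat"
  where "rep_dim \<pi> = dim_row (\<pi> 0)"

definition rep_equiv ::
    "(('g::topological_group_add \<Rightarrow> complex mat) \<times> ('g \<Rightarrow> complex mat)) set"
  where "rep_equiv = {(\<pi>, \<sigma>). \<pi> \<in> irreps \<and> \<sigma> \<in> irreps \<and> rep_dim \<pi> = rep_dim \<sigma> \<and>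
    (\<exists>U. unitary_mat (rep_dim \<pi>) U \<and> (\<forall>t. U * \<pi> t = \<sigma> t * U))}"

definition dual_group :: "('g::topological_group_add \<Rightarrow> complex mat) set set"
  where "dual_group = irreps // rep_equiv"

definition fourier_coeff ::
    "('e::ab_group_add, 'm) mnormed_scheme \<Rightarrow> ('g::topological_group_add \<Rightarrow> complex mat) \<Rightarrow>
     ('g set \<Rightarrow> 'e) \<Rightarrow> nat \<Rightarrow> nat \<Rightarrow> 'e"
  where "fourier_coeff V \<pi> \<nu> = (\<lambda>i j. if i < rep_dim \<pi> \<and> j < rep_dim \<pi>
    then scal V (1 / of_nat (rep_dim \<pi>)) (vector_integral V \<nu> (\<lambda>t. cnj (\<pi> t $$ (j, i)))) else 0)"

text \<open>Here \<open>\<rho>\<close> chooses, for each class, a representative together with an orthonormal basis.\<close>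

definition fourier ::
    "('e::ab_group_add, 'm) mnormed_scheme \<Rightarrow>
     (('g::topological_group_add \<Rightarrow> complex mat) set \<Rightarrow> 'g \<Rightarrow> complex mat) \<Rightarrow>
     ('g set \<Rightarrow> 'e) \<Rightarrow> ('g \<Rightarrow> complex mat) set \<Rightarrow> nat \<Rightarrow> nat \<Rightarrow> 'e"
  where "fourier V \<rho> \<nu> = (\<lambda>c. if c \<in> dual_group then fourier_coeff V (\<rho> c) \<nu> else 0)"

definition fourier_target ::
    "('e::ab_group_add, 'm) mnormed_scheme \<Rightarrow>
     (('g::topological_group_add \<Rightarrow> complex mat) set \<Rightarrow> 'g \<Rightarrow> complex mat) \<Rightarrow>
     (('g \<Rightarrow> complex mat) set \<Rightarrow> nat \<Rightarrow> nat \<Rightarrow> 'e) mnormed"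
  where "fourier_target V \<rho> = linf_sum dual_group (\<lambda>c. Mat_os (rep_dim (\<rho> c)) V)"

end

theory Submission
  imports Defs
begin

text \<open>
  Let \<open>\<pi>\<close> be an irreducible unitary representation of dimension \<open>d\<close> and \<open>\<nu>\<close> a vector measure.
  The matrix coefficients of \<open>\<pi>\<close> have modulus at most \<open>1\<close>, so every integral
  \<open>\<integral> cnj \<pi>\<^sub>j\<^sub>i d\<nu>\<close> has norm at most the semivariation of \<open>\<nu>\<close> (\<open>nrm_weak_integral_le\<close>). The
  \<open>d \<times> d\<close> matrix of these integrals is the sum of its \<open>d\<close> cyclic diagonals \<open>j = i + s mod d\<close>.
  After a permutation of the columns such a diagonal is a diagonal matrix, so by Ruan's axioms its
  norm is the maximum of the norms of its entries. Hence the matrix has norm at most \<open>d\<close> times the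
  semivariation, and the factor \<open>1 / d\<close> in the definition of the Fourier transform makes it a
  contraction.

  The same argument with blocks in place of entries gives complete boundedness, with constant \<open>1\<close>.
  An \<open>n \<times> n\<close> matrix of measures is a measure with values in \<open>M\<^sub>n(X)\<close> whose integral is taken
  entrywise (\<open>matrix_weak_integral\<close>). Its Fourier coefficient, read as an \<open>nd \<times> nd\<close> matrix, is up
  to reordering of indices a \<open>d \<times> d\<close> matrix of blocks from \<open>M\<^sub>n(X)\<close>, and again consists of \<open>d\<close>
  cyclic block diagonals (\<open>mnrm_le_dim_times_blocks\<close>).

  The analysis behind this concerns the integral, which is defined weakly. The Hahn--Banach theorem
  (\<open>hahn_banach\<close>) makes it unique and gives its norm bound. Completeness of \<open>X\<close> makes it exist for
  bounded Borel functions, as a limit of integrals of simple functions (\<open>weak_integral_exists\<close>).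
  The range of a vector measure is bounded (\<open>vector_measure_bounded\<close>), hence the semivariation is
  finite, also for measures with values in \<open>M\<^sub>n(X)\<close>; without that, the real number assigned to it
  as a norm would bound nothing.
\<close>

section \<open>Complex normed spaces and the Hahn--Banach theorem\<close>

context complex_normed_space
begin

lemma scal_zero_left: "x \<in> vecs E \<Longrightarrow> scal E 0 x = 0"
  using scal_add_left[of x 0 0] by simp

lemma scal_zero_right: "scal E a 0 = 0"
  using scal_add_right[OF zero_mem zero_mem, of a] by simp

lemma scal_minus_one: "x \<in> vecs E \<Longrightarrow> scal E (- 1) x = - x"
  using scal_add_left[of x 1 "- 1"] scal_one[of x] scal_zero_left[of x]
  by (simp add: eq_neg_iff_add_eq_0 add.commute)

lemma minus_mem: "x \<in> vecs E \<Longrightarrow> - x \<in> vecs E"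
  using scal_mem[of x "- 1"] by (simp add: scal_minus_one)

lemma diff_mem: "x \<in> vecs E \<Longrightarrow> y \<in> vecs E \<Longrightarrow> x - y \<in> vecs E"
  using add_mem[of x "- y"] minus_mem by simp

lemma sum_mem: "(\<And>i. i \<in> I \<Longrightarrow> x i \<in> vecs E) \<Longrightarrow> (\<Sum>i\<in>I. x i) \<in> vecs E"
  by (induction I rule: infinite_finite_induct) (auto simp: zero_mem add_mem)

lemma scal_minus_right: "x \<in> vecs E \<Longrightarrow> scal E a (- x) = - scal E a x"
  using scal_add_right[of x "- x" a] minus_mem[of x] scal_zero_right[of a]
  by (simp add: eq_neg_iff_add_eq_0 add.commute)

lemma scal_diff_right:
  "x \<in> vecs E \<Longrightarrow> y \<in> vecs E \<Longrightarrow> scal E a (x - y) = scal E a x - scal E a y"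
  using scal_add_right[of x "- y" a] minus_mem[of y] scal_minus_right[of y a] by simp

lemma nrm_zero: "nrm E 0 = 0"
  using nrm_eq_zero[OF zero_mem] by simp

lemma nrm_minus: "x \<in> vecs E \<Longrightarrow> nrm E (- x) = nrm E x"
  using nrm_scal[of x "- 1"] by (simp add: scal_minus_one)

lemma nrm_minus_commute: "x \<in> vecs E \<Longrightarrow> y \<in> vecs E \<Longrightarrow> nrm E (x - y) = nrm E (y - x)"
  using nrm_minus[OF diff_mem[of x y]] by simp

lemma nrm_ge_0: "x \<in> vecs E \<Longrightarrow> 0 \<le> nrm E x"
  using nrm_triangle[of x "- x"] minus_mem[of x] nrm_minus[of x] nrm_zero by simp

lemma nrm_triangle_diff: "x \<in> vecs E \<Longrightarrow> y \<in> vecs E \<Longrightarrow> nrm E x - nrm E y \<le> nrm E (x - y)"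
  using nrm_triangle[OF diff_mem[of x y], of y] by simp

lemma nrm_sum: "(\<And>i. i \<in> I \<Longrightarrow> x i \<in> vecs E) \<Longrightarrow> nrm E (\<Sum>i\<in>I. x i) \<le> (\<Sum>i\<in>I. nrm E (x i))"
proof (induction I rule: infinite_finite_induct)
  case (insert j I)
  then show ?case using nrm_triangle[of "x j" "sum x I"] sum_mem[of I x] by fastforce
qed (auto simp: nrm_zero)

subsection \<open>Minimal sublinear functionals\<close>

text \<open>The value \<open>0\<close> off the carrier makes the pointwise order antisymmetric.\<close>

definition sublinear :: "('e \<Rightarrow> real) \<Rightarrow> bool" where
  "sublinear p \<longleftrightarrow>
    (\<forall>x\<in>vecs E. \<forall>y\<in>vecs E. p (x + y) \<le> p x + p y) \<and>
    (\<forall>r>0. \<forall>x\<in>vecs E. p (scal E (of_real r) x) \<le> r * p x) \<and>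
    (\<forall>x. x \<notin> vecs E \<longrightarrow> p x = 0)"

lemma sublinear_add: "sublinear p \<Longrightarrow> x \<in> vecs E \<Longrightarrow> y \<in> vecs E \<Longrightarrow> p (x + y) \<le> p x + p y"
  by (simp add: sublinear_def)

lemma sublinear_scal:
  assumes p: "sublinear p" and r: "0 < r" and x: "x \<in> vecs E"
  shows "p (scal E (of_real r) x) = r * p x"
proof (rule antisym)
  show "p (scal E (of_real r) x) \<le> r * p x" using p r x by (simp add: sublinear_def)
  have "p (scal E (of_real (1 / r)) (scal E (of_real r) x)) \<le> (1 / r) * p (scal E (of_real r) x)"
    using p r scal_mem[OF x] unfolding sublinear_def by (meson zero_less_divide_1_iff)
  moreover have "scal E (of_real (1 / r)) (scal E (of_real r) x) = x"
    using r x by (simp add: scal_scal scal_one)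
  ultimately show "r * p x \<le> p (scal E (of_real r) x)"
    using r by (simp add: field_simps)
qed

lemma sublinear_zero: "sublinear p \<Longrightarrow> p 0 = 0"
  using sublinear_scal[of p 2 0] by (simp add: scal_zero_right zero_mem)

lemma sublinear_ge: "sublinear p \<Longrightarrow> x \<in> vecs E \<Longrightarrow> - p (- x) \<le> p x"
  using sublinear_add[of p x "- x"] by (simp add: minus_mem sublinear_zero)

text \<open>Replacing \<open>x\<close> by \<open>x + t y\<close> and subtracting \<open>t p(y)\<close> can only lower \<open>p\<close>; the infimum is the
  largest sublinear functional below \<open>p\<close> which is additive along the ray through \<open>y\<close>.\<close>

definition slide :: "('e \<Rightarrow> real) \<Rightarrow> 'e \<Rightarrow> 'e \<Rightarrow> real" where
  "slide p y x =
    (if x \<in> vecs E then INF t\<in>{0..}. p (x + scal E (of_real t) y) - t * p y else 0)"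

lemma slide_le:
  assumes p: "sublinear p" and x: "x \<in> vecs E" and y: "y \<in> vecs E" and t: "0 \<le> t"
  shows "slide p y x \<le> p (x + scal E (of_real t) y) - t * p y"
proof -
  have "- p (- x) \<le> p (x + scal E (of_real s) y) - s * p y" if "0 \<le> s" for s
  proof (cases "s = 0")
    case True
    then show ?thesis using sublinear_ge[OF p x] by (simp add: scal_zero_left y)
  next
    case False
    then have "s * p y = p (- x + (x + scal E (of_real s) y))"
      using sublinear_scal[OF p _ y, of s] that by simp
    also have "\<dots> \<le> p (- x) + p (x + scal E (of_real s) y)"
      by (intro sublinear_add p minus_mem add_mem x scal_mem y)
    finally show ?thesis by simp
  qed
  then have "bdd_below ((\<lambda>t. p (x + scal E (of_real t) y) - t * p y) ` {0..})"
    by (intro bdd_belowI2[of _ "- p (- x)"]) auto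
  then show ?thesis
    unfolding slide_def using t x by (auto intro: cINF_lower)
qed

lemma slide_greatest:
  assumes "x \<in> vecs E" "\<And>t. 0 \<le> t \<Longrightarrow> m \<le> p (x + scal E (of_real t) y) - t * p y"
  shows "m \<le> slide p y x"
  unfolding slide_def using assms by (auto intro!: cINF_greatest)

lemma slide_le_self: "sublinear p \<Longrightarrow> y \<in> vecs E \<Longrightarrow> slide p y x \<le> p x"
  using slide_le[of p x y 0] by (cases "x \<in> vecs E") (auto simp: scal_zero_left slide_def sublinear_def)

lemma sublinear_slide:
  assumes p: "sublinear p" and y: "y \<in> vecs E"
  shows "sublinear (slide p y)"
  unfolding sublinear_def
proof (intro conjI ballI allI impI)
  fix x z assume x: "x \<in> vecs E" and z: "z \<in> vecs E"
  have step: "slide p y (x + z) \<le>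
      (p (x + scal E (of_real s) y) - s * p y) + (p (z + scal E (of_real t) y) - t * p y)"
    if s: "0 \<le> s" and t: "0 \<le> t" for s t
  proof -
    have "slide p y (x + z) \<le> p (x + z + scal E (of_real (s + t)) y) - (s + t) * p y"
      using s t by (intro slide_le p y add_mem x z) auto
    also have "x + z + scal E (of_real (s + t)) y
        = (x + scal E (of_real s) y) + (z + scal E (of_real t) y)"
      using y by (simp add: scal_add_left algebra_simps)
    also have "p \<dots> \<le> p (x + scal E (of_real s) y) + p (z + scal E (of_real t) y)"
      by (intro sublinear_add p add_mem x z scal_mem y)
    finally show ?thesis by (simp add: algebra_simps)
  qed
  have "slide p y (x + z) - (p (x + scal E (of_real s) y) - s * p y) \<le> slide p y z"
    if "0 \<le> s" for s
    using step[OF that] z by (intro slide_greatest) (auto simp: algebra_simps)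
  then have "slide p y (x + z) - slide p y z \<le> slide p y x"
    using x by (intro slide_greatest) (auto simp: algebra_simps)
  then show "slide p y (x + z) \<le> slide p y x + slide p y z" by simp
next
  fix r :: real and x assume r: "0 < r" and x: "x \<in> vecs E"
  have "slide p y (scal E (of_real r) x) / r \<le> slide p y x"
  proof (rule slide_greatest[OF x])
    fix t :: real assume t: "0 \<le> t"
    have "slide p y (scal E (of_real r) x)
        \<le> p (scal E (of_real r) x + scal E (of_real (r * t)) y) - (r * t) * p y"
      using r t by (intro slide_le p y scal_mem x) auto
    also have "scal E (of_real r) x + scal E (of_real (r * t)) y
        = scal E (of_real r) (x + scal E (of_real t) y)"
      using x y by (simp add: scal_add_right scal_scal scal_mem)
    also have "p \<dots> = r * p (x + scal E (of_real t) y)"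
      by (intro sublinear_scal p r add_mem x scal_mem y)
    finally show "slide p y (scal E (of_real r) x) / r \<le> p (x + scal E (of_real t) y) - t * p y"
      using r by (simp add: field_simps)
  qed
  then show "slide p y (scal E (of_real r) x) \<le> r * slide p y x"
    using r by (simp add: field_simps)
qed (simp add: slide_def)

lemma sublinear_INF_chain:
  assumes C: "C \<noteq> {}" "\<And>q. q \<in> C \<Longrightarrow> sublinear q \<and> q \<le> p"
    and chain: "\<And>q r. q \<in> C \<Longrightarrow> r \<in> C \<Longrightarrow> q \<le> r \<or> r \<le> q"
  shows "sublinear (\<lambda>x. INF q\<in>C. q x)" and "q \<in> C \<Longrightarrow> (INF q\<in>C. q x) \<le> q x"
proof -
  have "bdd_below ((\<lambda>q. q x) ` C)" if x: "x \<in> vecs E" for x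
  proof (rule bdd_belowI2)
    fix q assume q: "q \<in> C"
    have "- p (- x) \<le> - q (- x)" using C(2)[OF q] by (simp add: le_funD)
    also have "\<dots> \<le> q x" using C(2)[OF q] x sublinear_ge by blast
    finally show "- p (- x) \<le> q x" .
  qed
  then have low: "(INF q\<in>C. q x) \<le> q x" if "x \<in> vecs E" "q \<in> C" for x q
    using that by (intro cINF_lower)
  have off: "(INF q\<in>C. q x) = 0" if "x \<notin> vecs E" for x
  proof -
    have "(\<lambda>q. q x) ` C = {0}" using C that by (auto simp: sublinear_def image_iff)
    then show ?thesis by simp
  qed
  show "(INF q\<in>C. q x) \<le> q x" if "q \<in> C" for q
    using low[of x q] off[of x] C(2)[OF that] that by (cases "x \<in> vecs E") (auto simp: sublinear_def)
  show "sublinear (\<lambda>x. INF q\<in>C. q x)"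
    unfolding sublinear_def
  proof (intro conjI ballI allI impI)
    fix x y assume x: "x \<in> vecs E" and y: "y \<in> vecs E"
    have low_add: "(INF q\<in>C. q (x + y)) \<le> q x + r y" if q: "q \<in> C" and r: "r \<in> C" for q r
    proof -
      obtain s where s: "s \<in> C" "s \<le> q" "s \<le> r" using chain[OF q r] q r by blast
      have "(INF q\<in>C. q (x + y)) \<le> s (x + y)" by (rule low[OF add_mem[OF x y] s(1)])
      also have "\<dots> \<le> s x + s y" using C(2)[OF s(1)] x y by (simp add: sublinear_add)
      also have "\<dots> \<le> q x + r y" using s(2,3) by (simp add: le_fun_def add_mono)
      finally show ?thesis .
    qed
    have "(INF q\<in>C. q (x + y)) - q x \<le> (INF q\<in>C. q y)" if "q \<in> C" for q
      using low_add[OF that] C(1) by (intro cINF_greatest) (simp_all add: diff_le_eq add.commute)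
    then have "(INF q\<in>C. q (x + y)) - (INF q\<in>C. q y) \<le> (INF q\<in>C. q x)"
      using C(1) by (intro cINF_greatest) (auto simp: algebra_simps)
    then show "(INF q\<in>C. q (x + y)) \<le> (INF q\<in>C. q x) + (INF q\<in>C. q y)" by simp
  next
    fix r :: real and x assume r: "0 < r" and x: "x \<in> vecs E"
    have "(INF q\<in>C. q (scal E (of_real r) x)) / r \<le> (INF q\<in>C. q x)"
    proof (rule cINF_greatest[OF C(1)])
      fix q assume q: "q \<in> C"
      have "(INF q\<in>C. q (scal E (of_real r) x)) \<le> r * q x"
        using low[OF scal_mem[OF x] q, of "of_real r"] C(2)[OF q] sublinear_scal[OF _ r x] by simp
      then show "(INF q\<in>C. q (scal E (of_real r) x)) / r \<le> q x"
        using r by (simp add: field_simps)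
    qed
    then show "(INF q\<in>C. q (scal E (of_real r) x)) \<le> r * (INF q\<in>C. q x)"
      using r by (simp add: field_simps)
  qed (rule off)
qed

text \<open>A minimal sublinear functional \<open>m\<close> is its own slide along every \<open>y\<close>, and this forces
  \<open>m(x) + m(y) \<le> m(x + y)\<close>.\<close>

lemma exists_additive_below_sublinear:
  assumes p: "sublinear p"
  obtains m where "sublinear m" "m \<le> p" "\<And>x y. x \<in> vecs E \<Longrightarrow> y \<in> vecs E \<Longrightarrow> m (x + y) = m x + m y"
proof -
  define A where "A = {q. sublinear q \<and> q \<le> p}"
  have "\<exists>m\<in>A. \<forall>a\<in>A. a \<le> m \<longrightarrow> a = m"
  proof (rule predicate_Zorn[where P = "\<lambda>q r. r \<le> q"])
    show "partial_order_on A (relation_of (\<lambda>q r. r \<le> q) A)"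
      by (intro partial_order_on_relation_ofI) auto
    fix C assume C: "C \<in> Chains (relation_of (\<lambda>q r. r \<le> q) A)"
    show "\<exists>u\<in>A. \<forall>a\<in>C. u \<le> a"
    proof (cases "C = {}")
      case True
      then show ?thesis using p by (auto simp: A_def)
    next
      case False
      have CA: "\<And>q. q \<in> C \<Longrightarrow> sublinear q \<and> q \<le> p"
        and chain: "\<And>q r. q \<in> C \<Longrightarrow> r \<in> C \<Longrightarrow> q \<le> r \<or> r \<le> q"
        using C unfolding Chains_def relation_of_def A_def by auto
      note inf = sublinear_INF_chain[OF False CA chain]
      let ?u = "\<lambda>x. INF q\<in>C. q x"
      have below: "?u \<le> a" if "a \<in> C" for a
        by (rule le_funI, rule inf(2)) (use that in auto)
      moreover have "?u \<le> p" using False below CA order_trans by blast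
      ultimately show ?thesis using inf(1) by (intro bexI[of _ ?u]) (auto simp: A_def)
    qed
  qed
  then obtain m where m: "sublinear m" "m \<le> p" and min: "\<And>q. sublinear q \<Longrightarrow> q \<le> p \<Longrightarrow> q \<le> m \<Longrightarrow> q = m"
    unfolding A_def by blast
  have "m (x + y) = m x + m y" if x: "x \<in> vecs E" and y: "y \<in> vecs E" for x y
  proof (rule antisym)
    show "m (x + y) \<le> m x + m y" by (rule sublinear_add[OF m(1) x y])
    have "slide m y \<le> m" using slide_le_self[OF m(1) y] by (simp add: le_fun_def)
    moreover from this m(2) have "slide m y \<le> p" by (rule order_trans)
    ultimately have "slide m y = m" using min[OF sublinear_slide[OF m(1) y]] by blast
    then have "m x \<le> m (x + scal E (of_real 1) y) - 1 * m y"
      using slide_le[OF m(1) x y, of 1] by simp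
    then show "m x + m y \<le> m (x + y)" using y by (simp add: scal_one)
  qed
  with m that show ?thesis by blast
qed

subsection \<open>Bounded functionals\<close>

lemma dualI:
  assumes lin: "linear_map E scalar_field f" and bd: "\<And>x. x \<in> vecs E \<Longrightarrow> cmod (f x) \<le> K * nrm E x"
  shows "f \<in> dual E"
proof -
  have "ennreal (cmod (f x)) \<le> ennreal \<bar>K\<bar>" if "x \<in> vecs E" "nrm E x \<le> 1" for x
  proof -
    have "cmod (f x) \<le> K * nrm E x" using bd that by blast
    also have "\<dots> \<le> \<bar>K\<bar> * nrm E x" using nrm_ge_0[OF that(1)] by (intro mult_right_mono) auto
    also have "\<dots> \<le> \<bar>K\<bar>" using mult_left_mono[OF that(2), of "\<bar>K\<bar>"] by simp
    finally show ?thesis by (rule ennreal_leI)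
  qed
  then have "op_norm E scalar_field f \<le> ennreal \<bar>K\<bar>"
    unfolding op_norm_def by (intro SUP_least) (auto simp: scalar_field_def)
  then show ?thesis
    using lin unfolding dual_def by (auto simp: top.not_eq_extremum intro: le_less_trans)
qed

lemma dual_add: "f \<in> dual E \<Longrightarrow> x \<in> vecs E \<Longrightarrow> y \<in> vecs E \<Longrightarrow> f (x + y) = f x + f y"
  by (simp add: dual_def linear_map_def)

lemma dual_scal: "f \<in> dual E \<Longrightarrow> x \<in> vecs E \<Longrightarrow> f (scal E a x) = a * f x"
  by (simp add: dual_def linear_map_def scalar_field_def)

lemma dual_zero: "f \<in> dual E \<Longrightarrow> f 0 = 0"
  using dual_add[of f 0 0] by (simp add: zero_mem)

lemma dual_minus: "f \<in> dual E \<Longrightarrow> x \<in> vecs E \<Longrightarrow> f (- x) = - f x"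
  using dual_scal[of f x "- 1"] by (simp add: scal_minus_one)

lemma dual_diff: "f \<in> dual E \<Longrightarrow> x \<in> vecs E \<Longrightarrow> y \<in> vecs E \<Longrightarrow> f (x - y) = f x - f y"
  using dual_add[of f x "- y"] dual_minus[of f y] minus_mem[of y] by simp

lemma dual_sum: "f \<in> dual E \<Longrightarrow> (\<And>i. i \<in> I \<Longrightarrow> x i \<in> vecs E) \<Longrightarrow> f (\<Sum>i\<in>I. x i) = (\<Sum>i\<in>I. f (x i))"
  by (induction I rule: infinite_finite_induct) (auto simp: dual_zero dual_add sum_mem)

lemma op_norm_bound:
  assumes f: "f \<in> dual E" and K: "op_norm E scalar_field f \<le> ennreal K" "0 \<le> K" and x: "x \<in> vecs E"
  shows "cmod (f x) \<le> K * nrm E x"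
proof (cases "x = 0")
  case True
  then show ?thesis using dual_zero[OF f] nrm_zero by simp
next
  case False
  define r where "r = nrm E x"
  have r: "0 < r" using nrm_eq_zero[OF x] nrm_ge_0[OF x] False unfolding r_def by linarith
  let ?y = "scal E (of_real (1 / r)) x"
  have "nrm E ?y = 1" using r by (simp add: nrm_scal[OF x] r_def[symmetric] norm_divide)
  then have "ennreal (cmod (f ?y)) \<le> op_norm E scalar_field f"
    unfolding op_norm_def using scal_mem[OF x] by (intro SUP_upper2[of ?y]) (auto simp: scalar_field_def)
  also note K(1)
  finally have "cmod (f ?y) \<le> K" using K(2) by simp
  then show ?thesis
    using r by (simp add: dual_scal[OF f x] norm_divide field_simps r_def[symmetric])
qed

lemma dual_bound:
  assumes f: "f \<in> dual E"
  obtains K where "0 \<le> K" "\<And>x. x \<in> vecs E \<Longrightarrow> cmod (f x) \<le> K * nrm E x"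
proof -
  have "op_norm E scalar_field f < \<infinity>" using f by (simp add: dual_def)
  then obtain K where "0 \<le> K" "op_norm E scalar_field f = ennreal K"
    by (cases "op_norm E scalar_field f") auto
  then show thesis using that op_norm_bound[OF f] by auto
qed

lemma dual_ball_bound: "f \<in> dual_ball E \<Longrightarrow> x \<in> vecs E \<Longrightarrow> cmod (f x) \<le> nrm E x"
  using op_norm_bound[of f 1 x] by (simp add: dual_ball_def)

lemma dual_ball_dual: "f \<in> dual_ball E \<Longrightarrow> f \<in> dual E"
  by (simp add: dual_ball_def)

text \<open>The functional \<open>slide nrm x\<^sub>0\<close> takes a value at most \<open>- nrm x\<^sub>0\<close> at \<open>- x\<^sub>0\<close>, so an additive
  functional \<open>m\<close> below it is norming at \<open>x\<^sub>0\<close>. The complex functional with real part \<open>m\<close> is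
  \<open>m(x) - \<i> m(\<i> x)\<close>, and rotating its value to the positive axis shows that it is a
  contraction.\<close>

theorem hahn_banach:
  assumes x0: "x0 \<in> vecs E"
  obtains f where "f \<in> dual_ball E" "nrm E x0 \<le> cmod (f x0)"
proof -
  define p where "p x = (if x \<in> vecs E then nrm E x else 0)" for x
  have p: "sublinear p"
    unfolding sublinear_def p_def by (auto simp: add_mem scal_mem nrm_triangle nrm_scal)
  obtain m where m: "sublinear m" "m \<le> slide p x0"
    and add: "\<And>x y. x \<in> vecs E \<Longrightarrow> y \<in> vecs E \<Longrightarrow> m (x + y) = m x + m y"
    using exists_additive_below_sublinear[OF sublinear_slide[OF p x0]] by blast
  have le: "m x \<le> nrm E x" if "x \<in> vecs E" for x
    using le_funD[OF m(2), of x] slide_le_self[OF p x0, of x] that by (simp add: p_def)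
  have neg: "m (- x) = - m x" if "x \<in> vecs E" for x
    using add[OF that minus_mem[OF that]] sublinear_zero[OF m(1)] by simp
  have real_scal: "m (scal E (of_real r) x) = r * m x" if x: "x \<in> vecs E" for r x
  proof -
    consider "r = 0" | "0 < r" | "0 < - r" by linarith
    then show ?thesis
    proof cases
      case 1
      then show ?thesis by (simp add: scal_zero_left x sublinear_zero[OF m(1)])
    next
      case 2
      then show ?thesis by (rule sublinear_scal[OF m(1) _ x])
    next
      case 3
      have "scal E (of_real r) x = scal E (of_real (- r)) (- x)"
        using scal_scal[OF x, of "of_real (- r)" "- 1"] by (simp add: scal_minus_one x)
      then show ?thesis using sublinear_scal[OF m(1) 3 minus_mem[OF x]] neg[OF x] by simp
    qed
  qed
  define f where "f x = Complex (m x) (- m (scal E \<i> x))" for x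
  have scal_Complex: "scal E a x = scal E (of_real (Re a)) x + scal E (of_real (Im a)) (scal E \<i> x)"
    if "x \<in> vecs E" for a x
  proof -
    have "a = of_real (Re a) + of_real (Im a) * \<i>" by (simp add: complex_eq_iff)
    then show ?thesis using scal_add_left[OF that] scal_scal[OF that] by metis
  qed
  have m_scal: "m (scal E a x) = Re a * m x + Im a * m (scal E \<i> x)" if x: "x \<in> vecs E" for a x
    using scal_Complex[OF x, of a] x by (simp add: add scal_mem real_scal)
  have f_scal: "f (scal E a x) = a * f x" if x: "x \<in> vecs E" for a x
    using m_scal[OF x, of a] m_scal[OF x, of "\<i> * a"] x
    by (simp add: f_def complex_eq_iff scal_scal)
  have lin: "linear_map E scalar_field f"
    unfolding linear_map_def
    by (auto simp: scalar_field_def f_scal)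
      (simp add: f_def add scal_mem scal_add_right complex_eq_iff)
  have bd: "cmod (f x) \<le> nrm E x" if x: "x \<in> vecs E" for x
  proof (cases "f x = 0")
    case True
    then show ?thesis using nrm_ge_0[OF x] by simp
  next
    case False
    define u where "u = cnj (f x) / of_real (cmod (f x))"
    have u: "cmod u = 1" using False by (simp add: u_def norm_divide)
    have "f (scal E u x) = of_real (cmod (f x))"
      using False by (simp add: f_scal[OF x] u_def complex_norm_square[symmetric] power2_eq_square
          mult.commute[of "cnj (f x)"])
    then have "cmod (f x) = m (scal E u x)" by (simp add: f_def complex_eq_iff)
    also have "\<dots> \<le> nrm E x" using le[OF scal_mem[OF x], of u] by (simp add: nrm_scal[OF x] u)
    finally show ?thesis .
  qed
  have "f \<in> dual E" using bd by (intro dualI[OF lin, of 1]) auto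
  moreover have "op_norm E scalar_field f \<le> 1"
    unfolding op_norm_def using bd
    by (intro SUP_least) (auto simp: scalar_field_def ennreal_le_1 intro: order.trans)
  ultimately have ball: "f \<in> dual_ball E" by (simp add: dual_ball_def)
  have "m (- x0) \<le> slide p x0 (- x0)" using m(2) by (rule le_funD)
  also have "\<dots> \<le> - nrm E x0"
    using slide_le[OF p minus_mem[OF x0] x0, of 1] x0 by (simp add: scal_one p_def zero_mem nrm_zero)
  finally have "nrm E x0 \<le> Re (f x0)" using neg[OF x0] by (simp add: f_def)
  then have "nrm E x0 \<le> cmod (f x0)" using complex_Re_le_cmod order_trans by blast
  with ball show ?thesis by (rule that)
qed

corollary nrm_le_via_dual_ball:
  assumes "x \<in> vecs E" "\<And>f. f \<in> dual_ball E \<Longrightarrow> cmod (f x) \<le> M"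
  shows "nrm E x \<le> M"
  using hahn_banach[OF assms(1)] assms(2) order_trans by metis

corollary dual_separates:
  assumes x: "x \<in> vecs E" and y: "y \<in> vecs E" and eq: "\<And>f. f \<in> dual E \<Longrightarrow> f x = f y"
  shows "x = y"
proof -
  have "nrm E (x - y) \<le> 0"
    using eq by (intro nrm_le_via_dual_ball diff_mem x y) (simp add: dual_diff x y dual_ball_dual)
  then show ?thesis
    using nrm_eq_zero[OF diff_mem[OF x y]] nrm_ge_0[OF diff_mem[OF x y]] by simp
qed

end

section \<open>Vector measures\<close>

interpretation scalar_field: complex_normed_space scalar_field
proof
  show "nrm scalar_field (x + y) \<le> nrm scalar_field x + nrm scalar_field y" for x y
    by (simp add: scalar_field_def norm_triangle_ineq)
qed (simp_all add: scalar_field_def distrib_left distrib_right norm_mult)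

lemma scalar_field_simps [simp]:
  "vecs scalar_field = UNIV" "scal scalar_field = (*)" "nrm scalar_field = cmod"
  by (simp_all add: scalar_field_def)

context complex_normed_space
begin

lemma vector_measure_mem: "\<nu> \<in> vector_measures E \<Longrightarrow> \<nu> A \<in> vecs E"
  unfolding vector_measures_def using zero_mem by (cases "A \<in> sets borel") auto

lemma vector_measure_sigma_additive:
  "\<nu> \<in> vector_measures E \<Longrightarrow> range A \<subseteq> sets borel \<Longrightarrow> disjoint_family A \<Longrightarrow>
    (\<lambda>n. nrm E ((\<Sum>i<n. \<nu> (A i)) - \<nu> (\<Union>i. A i))) \<longlonglongrightarrow> 0"
  unfolding vector_measures_def by blast

lemma vector_measure_disjoint_tendsto_zero:
  assumes \<nu>: "\<nu> \<in> vector_measures E" and A: "range A \<subseteq> sets borel" "disjoint_family A"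
  shows "(\<lambda>n. nrm E (\<nu> (A n))) \<longlonglongrightarrow> 0"
proof -
  define r where "r n = (\<Sum>i<n. \<nu> (A i)) - \<nu> (\<Union>i. A i)" for n
  have r: "r n \<in> vecs E" for n
    unfolding r_def by (intro diff_mem sum_mem vector_measure_mem \<nu>)
  have lim: "(\<lambda>n. nrm E (r n)) \<longlonglongrightarrow> 0"
    unfolding r_def by (rule vector_measure_sigma_additive[OF \<nu> A])
  have "nrm E (\<nu> (A n)) \<le> nrm E (r (Suc n)) + nrm E (r n)" for n
    using nrm_triangle[OF r minus_mem[OF r], of "Suc n" n] nrm_minus[OF r, of n]
    by (simp add: r_def)
  then have le: "\<forall>\<^sub>F n in sequentially. nrm E (\<nu> (A n)) \<le> nrm E (r (Suc n)) + nrm E (r n)"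
    by (rule always_eventually[OF allI])
  have ge: "\<forall>\<^sub>F n in sequentially. 0 \<le> nrm E (\<nu> (A n))"
    by (rule always_eventually[OF allI], rule nrm_ge_0[OF vector_measure_mem[OF \<nu>]])
  have "(\<lambda>n. nrm E (r (Suc n)) + nrm E (r n)) \<longlonglongrightarrow> 0"
    using tendsto_add[OF LIMSEQ_Suc[OF lim] lim] by simp
  then show ?thesis by (rule tendsto_sandwich[OF ge le tendsto_const])
qed

lemma vector_measure_empty: 
  assumes \<nu>: "\<nu> \<in> vector_measures E"
  shows "\<nu> {} = 0"
proof -
  have "(\<lambda>n::nat. nrm E (\<nu> {})) \<longlonglongrightarrow> 0"
    using vector_measure_disjoint_tendsto_zero[OF \<nu>, of "\<lambda>_. {}"] by (auto simp: disjoint_family_on_def)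
  then show ?thesis
    using nrm_eq_zero[OF vector_measure_mem[OF \<nu>]] by (simp add: LIMSEQ_const_iff)
qed

lemma vector_measure_Un:
  assumes \<nu>: "\<nu> \<in> vector_measures E" and A: "A \<in> sets borel" and B: "B \<in> sets borel"
    and disj: "A \<inter> B = {}"
  shows "\<nu> (A \<union> B) = \<nu> A + \<nu> B"
proof -
  let ?C = "binaryset A B"
  have "(\<lambda>n. nrm E ((\<Sum>i<n. \<nu> (?C i)) - \<nu> (\<Union>i. ?C i))) \<longlonglongrightarrow> 0"
    using A B disj
    by (intro vector_measure_sigma_additive \<nu>)
      (auto simp: binaryset_def disjoint_family_on_def split: if_splits)
  then have "(\<lambda>n. nrm E ((\<Sum>i<Suc (Suc n). \<nu> (?C i)) - \<nu> (\<Union>i. ?C i))) \<longlonglongrightarrow> 0"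
    by (intro LIMSEQ_Suc[of "\<lambda>n. nrm E ((\<Sum>i<Suc n. \<nu> (?C i)) - \<nu> (\<Union>i. ?C i))"]
        LIMSEQ_Suc[of "\<lambda>n. nrm E ((\<Sum>i<n. \<nu> (?C i)) - \<nu> (\<Union>i. ?C i))"])
  moreover have "(\<Sum>i<Suc (Suc n). \<nu> (?C i)) = \<nu> A + \<nu> B" for n
    by (simp only: sum.lessThan_Suc_shift) (simp add: binaryset_def vector_measure_empty[OF \<nu>])
  ultimately have "nrm E (\<nu> A + \<nu> B - \<nu> (A \<union> B)) = 0"
    by (simp add: UN_binaryset_eq LIMSEQ_const_iff)
  then show ?thesis
    using nrm_eq_zero[of "\<nu> A + \<nu> B - \<nu> (A \<union> B)"]
    by (simp add: diff_mem add_mem vector_measure_mem[OF \<nu>])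
qed

lemma vector_measure_Diff:
  assumes "\<nu> \<in> vector_measures E" "A \<in> sets borel" "B \<in> sets borel" "A \<subseteq> B"
  shows "\<nu> (B - A) = \<nu> B - \<nu> A"
  using vector_measure_Un[of \<nu> A "B - A"] assms by (auto simp: Un_absorb1)

lemma vector_measure_finite_UN:
  assumes \<nu>: "\<nu> \<in> vector_measures E" and I: "finite I" "\<And>i. i \<in> I \<Longrightarrow> A i \<in> sets borel"
    and disj: "disjoint_family_on A I"
  shows "\<nu> (\<Union>i\<in>I. A i) = (\<Sum>i\<in>I. \<nu> (A i))"
  using I disj
proof (induction I rule: finite_induct)
  case empty
  then show ?case by (simp add: vector_measure_empty[OF \<nu>])
next
  case (insert j I)
  have "A j \<inter> (\<Union>i\<in>I. A i) = {}"
    using insert.prems(2) insert.hyps(2) by (auto simp: disjoint_family_on_def)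
  then have "\<nu> (A j \<union> (\<Union>i\<in>I. A i)) = \<nu> (A j) + \<nu> (\<Union>i\<in>I. A i)"
    using insert.prems(1) insert.hyps(1) by (intro vector_measure_Un \<nu>) auto
  moreover have "disjoint_family_on A I"
    using insert.prems(2) by (auto simp: disjoint_family_on_def)
  ultimately show ?case using insert by simp
qed

text \<open>If some set had subsets of arbitrarily large measure, one could split it into two pieces with
  measures of norm greater than \<open>1\<close>, one of which has again subsets of arbitrarily large measure.
  Repeating this with that piece, the discarded pieces are disjoint and violate \<open>\<sigma>\<close>-additivity.\<close>

theorem vector_measure_bounded:
  assumes \<nu>: "\<nu> \<in> vector_measures E"
  obtains K where "0 \<le> K" "\<And>A. nrm E (\<nu> A) \<le> K"
proof -
  define big where "big A \<longleftrightarrow> A \<in> sets borel \<and> (\<forall>K. \<exists>B\<in>sets borel. B \<subseteq> A \<and> K < nrm E (\<nu> B))" for A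
  have split: "\<exists>B. big B \<and> B \<subseteq> A \<and> 1 < nrm E (\<nu> (A - B))" if A: "big A" for A
  proof -
    have Ab: "A \<in> sets borel" using A by (simp add: big_def)
    obtain B where B: "B \<in> sets borel" "B \<subseteq> A" "nrm E (\<nu> A) + 1 < nrm E (\<nu> B)"
      using A unfolding big_def by blast
    have AB: "\<nu> (A - B) = \<nu> A - \<nu> B" by (rule vector_measure_Diff[OF \<nu> B(1) Ab B(2)])
    have "nrm E (\<nu> B) - nrm E (\<nu> A) \<le> nrm E (\<nu> (A - B))"
      unfolding AB
      using nrm_triangle_diff[of "\<nu> B" "\<nu> A"] nrm_minus_commute[of "\<nu> A" "\<nu> B"] vector_measure_mem[OF \<nu>]
      by simp
    then have 1: "1 < nrm E (\<nu> (A - B))" using B(3) by simp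
    have 2: "1 < nrm E (\<nu> B)" using B(3) nrm_ge_0[OF vector_measure_mem[OF \<nu>], of A] by simp
    have "big B \<or> big (A - B)"
    proof (rule ccontr)
      assume "\<not> (big B \<or> big (A - B))"
      then obtain K L where K: "\<And>C. C \<in> sets borel \<Longrightarrow> C \<subseteq> B \<Longrightarrow> nrm E (\<nu> C) \<le> K"
        and L: "\<And>C. C \<in> sets borel \<Longrightarrow> C \<subseteq> A - B \<Longrightarrow> nrm E (\<nu> C) \<le> L"
        using B(1) Ab unfolding big_def by (meson not_less sets.Diff)
      obtain C where C: "C \<in> sets borel" "C \<subseteq> A" "K + L < nrm E (\<nu> C)"
        using A unfolding big_def by blast
      have "\<nu> ((C \<inter> B) \<union> (C - B)) = \<nu> (C \<inter> B) + \<nu> (C - B)"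
        using C(1) B(1) by (intro vector_measure_Un \<nu>) auto
      moreover have "(C \<inter> B) \<union> (C - B) = C" by blast
      ultimately have "nrm E (\<nu> C) \<le> nrm E (\<nu> (C \<inter> B)) + nrm E (\<nu> (C - B))"
        using nrm_triangle vector_measure_mem[OF \<nu>] by metis
      moreover have "nrm E (\<nu> (C \<inter> B)) \<le> K" "nrm E (\<nu> (C - B)) \<le> L"
        using C B(1) by (auto intro!: K L)
      ultimately show False using C(3) by linarith
    qed
    then show ?thesis
    proof
      assume "big B"
      then show ?thesis using B(2) 1 by blast
    next
      assume "big (A - B)"
      moreover have "A - (A - B) = B" using B(2) by blast
      ultimately show ?thesis using 2 by (intro exI[of _ "A - B"]) auto
    qed
  qed
  have "\<not> big UNIV"
  proof
    assume start: "big UNIV"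
    have "\<exists>A. \<forall>n::nat. big (A n) \<and> A (Suc n) \<subseteq> A n \<and> 1 < nrm E (\<nu> (A n - A (Suc n)))"
      by (rule dependent_nat_choice[where P = "\<lambda>_. big"]) (use start split in blast)+
    then obtain A where A: "\<And>n::nat. big (A n)" "\<And>n. A (Suc n) \<subseteq> A n"
        "\<And>n. 1 < nrm E (\<nu> (A n - A (Suc n)))"
      by blast
    have dec: "A n \<subseteq> A m" if "m \<le> n" for m n
      using lift_Suc_antimono_le[of A, OF A(2) that] .
    have "disjoint_family (\<lambda>n. A n - A (Suc n))"
      unfolding disjoint_family_on_def
    proof (intro ballI impI)
      fix m n :: nat assume "m \<noteq> n"
      then have "A n \<subseteq> A (Suc m) \<or> A m \<subseteq> A (Suc n)" using dec[of "Suc m" n] dec[of "Suc n" m] by linarith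
      then show "(A m - A (Suc m)) \<inter> (A n - A (Suc n)) = {}" by blast
    qed
    moreover have "range (\<lambda>n. A n - A (Suc n)) \<subseteq> sets borel"
      using A(1) unfolding big_def by blast
    ultimately have "(\<lambda>n. nrm E (\<nu> (A n - A (Suc n)))) \<longlonglongrightarrow> 0"
      by (intro vector_measure_disjoint_tendsto_zero \<nu>)
    then have "1 \<le> (0::real)" using A(3) by (intro LIMSEQ_le_const) (auto intro: less_imp_le)
    then show False by simp
  qed
  then obtain K where K: "\<And>A. A \<in> sets borel \<Longrightarrow> nrm E (\<nu> A) \<le> K"
    unfolding big_def by (auto simp: not_less)
  have "nrm E (\<nu> A) \<le> \<bar>K\<bar>" for A
  proof (cases "A \<in> sets borel")
    case False
    then have "\<nu> A = 0" using \<nu> unfolding vector_measures_def by blast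
    then show ?thesis by (simp add: nrm_zero)
  qed (use K[of A] in linarith)
  then show thesis using that[of "\<bar>K\<bar>"] by simp
qed

lemma dual_compose_vector_measure:
  assumes f: "f \<in> dual E" and \<nu>: "\<nu> \<in> vector_measures E"
  shows "(\<lambda>A. f (\<nu> A)) \<in> vector_measures scalar_field"
proof -
  obtain K where K: "0 \<le> K" "\<And>x. x \<in> vecs E \<Longrightarrow> cmod (f x) \<le> K * nrm E x" by (rule dual_bound[OF f]) blast
  have "(\<lambda>n. cmod ((\<Sum>i<n. f (\<nu> (A i))) - f (\<nu> (\<Union>i. A i)))) \<longlonglongrightarrow> 0"
    if A: "range A \<subseteq> sets borel" "disjoint_family A" for A :: "nat \<Rightarrow> _ set"
  proof (rule tendsto_sandwich[OF _ _ tendsto_const])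
    show "(\<lambda>n. K * nrm E ((\<Sum>i<n. \<nu> (A i)) - \<nu> (\<Union>i. A i))) \<longlonglongrightarrow> 0"
      using tendsto_mult_left[OF vector_measure_sigma_additive[OF \<nu> A], of K] by simp
    have "(\<Sum>i<n. f (\<nu> (A i))) - f (\<nu> (\<Union>i. A i)) = f ((\<Sum>i<n. \<nu> (A i)) - \<nu> (\<Union>i. A i))" for n
      by (simp add: dual_sum[OF f] dual_diff[OF f] sum_mem vector_measure_mem[OF \<nu>])
    then show "\<forall>\<^sub>F n in sequentially. cmod ((\<Sum>i<n. f (\<nu> (A i))) - f (\<nu> (\<Union>i. A i)))
        \<le> K * nrm E ((\<Sum>i<n. \<nu> (A i)) - \<nu> (\<Union>i. A i))"
      using K(2) by (simp add: diff_mem sum_mem vector_measure_mem[OF \<nu>])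
  qed auto
  moreover have "f (\<nu> A) = 0" if "A \<notin> sets borel" for A
    using \<nu> that dual_zero[OF f] by (simp add: vector_measures_def)
  ultimately show ?thesis unfolding vector_measures_def by simp
qed

end

subsection \<open>Semivariation\<close>

text \<open>Over the blocks of a partition on which \<open>Re \<mu>\<close> is nonnegative, the values \<open>\<bar>Re \<mu>\<bar>\<close> add up to
  the value of \<open>Re \<mu>\<close> at the union, and similarly for the other three signs.\<close>

lemma total_variation_le:
  assumes \<mu>: "\<mu> \<in> vector_measures scalar_field" and K: "\<And>A. cmod (\<mu> A) \<le> K"
  shows "total_variation \<mu> A \<le> ennreal (4 * K)"
  unfolding total_variation_def
proof (rule SUP_least)
  fix P assume "P \<in> {P. finite P \<and> partition_on A P \<and> P \<subseteq> sets borel}"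
  then have fin: "finite P" and disj: "disjoint P" and P: "P \<subseteq> sets borel"
    by (auto simp: partition_on_def)
  have sum_le: "cmod (\<Sum>B\<in>Q. \<mu> B) \<le> K" if "Q \<subseteq> P" for Q
  proof -
    have "\<mu> (\<Union>B\<in>Q. B) = (\<Sum>B\<in>Q. \<mu> B)"
      using that fin disj P
      by (intro scalar_field.vector_measure_finite_UN \<mu>)
        (auto intro: finite_subset simp: disjoint_family_on_def disjoint_def)
    then show ?thesis using K by metis
  qed
  have part: "(\<Sum>B\<in>P. \<bar>h (\<mu> B)\<bar>) \<le> 2 * K"
    if h: "\<And>Q. h (\<Sum>B\<in>Q. \<mu> B) = (\<Sum>B\<in>Q. h (\<mu> B))" "\<And>z. \<bar>h z\<bar> \<le> cmod z" for h :: "complex \<Rightarrow> real"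
  proof -
    let ?N = "{B\<in>P. 0 \<le> h (\<mu> B)}"
    have "(\<Sum>B\<in>P. \<bar>h (\<mu> B)\<bar>) = (\<Sum>B\<in>?N. \<bar>h (\<mu> B)\<bar>) + (\<Sum>B\<in>P - ?N. \<bar>h (\<mu> B)\<bar>)"
      using fin by (subst sum.subset_diff[of ?N]) auto
    also have "\<dots> = (\<Sum>B\<in>?N. h (\<mu> B)) - (\<Sum>B\<in>P - ?N. h (\<mu> B))"
      unfolding diff_conv_add_uminus sum_negf[symmetric]
      by (intro arg_cong2[of _ _ _ _ "(+)"] sum.cong) auto
    also have "\<dots> \<le> \<bar>h (\<Sum>B\<in>?N. \<mu> B)\<bar> + \<bar>h (\<Sum>B\<in>P - ?N. \<mu> B)\<bar>"
      unfolding h(1) by linarith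
    also have "\<dots> \<le> K + K"
      using sum_le[of ?N] sum_le[of "P - ?N"] by (intro add_mono order.trans[OF h(2)]) auto
    finally show ?thesis by simp
  qed
  have "(\<Sum>B\<in>P. cmod (\<mu> B)) \<le> (\<Sum>B\<in>P. \<bar>Re (\<mu> B)\<bar>) + (\<Sum>B\<in>P. \<bar>Im (\<mu> B)\<bar>)"
    unfolding sum.distrib[symmetric] by (intro sum_mono cmod_le)
  also have "\<dots> \<le> 4 * K"
    using part[of Re] part[of Im] by (simp add: abs_Re_le_cmod abs_Im_le_cmod)
  finally show "(\<Sum>B\<in>P. ennreal (cmod (\<mu> B))) \<le> ennreal (4 * K)"
    by (simp add: ennreal_leI)
qed

lemma total_variation_finite:
  assumes "\<mu> \<in> vector_measures scalar_field"
  shows "total_variation \<mu> A < \<infinity>"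
proof -
  obtain K where K: "\<And>A. nrm scalar_field (\<mu> A) \<le> K"
    using scalar_field.vector_measure_bounded[OF assms] by blast
  then have "total_variation \<mu> A \<le> ennreal (4 * K)"
    by (intro total_variation_le assms) simp
  then show ?thesis by (auto intro: le_less_trans)
qed

lemma (in complex_normed_space) semivariation_finite:
  assumes \<nu>: "\<nu> \<in> vector_measures E"
  shows "semivariation E \<nu> < \<infinity>"
proof -
  obtain K where K: "0 \<le> K" "\<And>A. nrm E (\<nu> A) \<le> K" using vector_measure_bounded[OF \<nu>] by metis
  have "semivariation E \<nu> \<le> ennreal (4 * K)"
    unfolding semivariation_def
  proof (rule SUP_least)
    fix f assume f: "f \<in> dual_ball E"
    have "cmod (f (\<nu> A)) \<le> K" for A
      using dual_ball_bound[OF f vector_measure_mem[OF \<nu>]] K(2) order_trans by blast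
    then show "total_variation (\<lambda>A. f (\<nu> A)) UNIV \<le> ennreal (4 * K)"
      by (intro total_variation_le dual_compose_vector_measure[OF _ \<nu>] dual_ball_dual f)
  qed
  then show ?thesis by (auto intro: le_less_trans)
qed

section \<open>Integration against complex measures\<close>

subsection \<open>Jordan decomposition of signed measures\<close>

locale finite_signed_measure =
  fixes m :: "'g::topological_space set \<Rightarrow> real"
  assumes sigma_additive:
      "range A \<subseteq> sets borel \<Longrightarrow> disjoint_family A \<Longrightarrow> (\<lambda>i. m (A i)) sums m (\<Union>i. A i)"
    and bounded: "\<exists>K. \<forall>A. \<bar>m A\<bar> \<le> K"
begin

definition upper :: "'g set \<Rightarrow> ennreal" where
  "upper A = (SUP B\<in>{B\<in>sets borel. B \<subseteq> A}. ennreal (m B))"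

lemma m_empty: "m {} = 0"
proof -
  have "summable (\<lambda>i::nat. m {})"
    using sigma_additive[of "\<lambda>_. {}"] by (simp add: disjoint_family_on_def sums_iff)
  then show ?thesis by (auto dest!: summable_LIMSEQ_zero simp: LIMSEQ_const_iff)
qed

lemma m_Un: "A \<in> sets borel \<Longrightarrow> B \<in> sets borel \<Longrightarrow> A \<inter> B = {} \<Longrightarrow> m (A \<union> B) = m A + m B"
proof -
  assume A: "A \<in> sets borel" and B: "B \<in> sets borel" and disj: "A \<inter> B = {}"
  have "(\<lambda>i. m (binaryset A B i)) sums m (\<Union>i. binaryset A B i)"
    using A B disj
    by (intro sigma_additive) (auto simp: binaryset_def disjoint_family_on_def split: if_splits)
  then have "(\<lambda>i. m (binaryset A B i)) sums m (A \<union> B)" by (simp add: UN_binaryset_eq)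
  moreover have "(\<lambda>i. m (binaryset A B i)) sums (m A + m B)" by (rule binaryset_sums[of m, OF m_empty])
  ultimately show ?thesis by (rule sums_unique2)
qed

lemma m_Diff: "A \<in> sets borel \<Longrightarrow> B \<in> sets borel \<Longrightarrow> A \<subseteq> B \<Longrightarrow> m (B - A) = m B - m A"
  using m_Un[of A "B - A"] by (auto simp: Un_absorb1)

lemma finite_signed_measure_minus: "finite_signed_measure (\<lambda>A. - m A)"
  by unfold_locales (use sigma_additive bounded in \<open>auto intro: sums_minus\<close>)

lemma upper_ge: "B \<in> sets borel \<Longrightarrow> B \<subseteq> A \<Longrightarrow> ennreal (m B) \<le> upper A"
  unfolding upper_def by (intro SUP_upper) auto

lemma upper_finite: "upper A < \<infinity>"
proof -
  obtain K where "\<And>A. \<bar>m A\<bar> \<le> K" using bounded by blast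
  then have "upper A \<le> ennreal K"
    unfolding upper_def by (intro SUP_least ennreal_leI) (meson abs_le_D1)
  then show ?thesis by (auto intro: le_less_trans)
qed

lemma upper_mono: "A \<subseteq> B \<Longrightarrow> upper A \<le> upper B"
  unfolding upper_def by (intro SUP_subset_mono) auto

lemma upper_empty: "upper {} = 0"
proof -
  have "{B \<in> sets borel. B \<subseteq> {}} = {{} :: 'g set}" by auto
  then show ?thesis unfolding upper_def by (simp add: m_empty)
qed

lemma upper_superadditive: "A \<inter> B = {} \<Longrightarrow> upper A + upper B \<le> upper (A \<union> B)"
proof -
  assume disj: "A \<inter> B = {}"
  have le: "ennreal (m C) + ennreal (m D) \<le> upper (A \<union> B)"
    if C: "C \<in> sets borel" "C \<subseteq> A" and D: "D \<in> sets borel" "D \<subseteq> B" for C D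
  proof -
    consider "m C \<le> 0" | "m D \<le> 0" | "0 \<le> m C" "0 \<le> m D" by linarith
    then show ?thesis
    proof cases
      case 1
      then show ?thesis using D by (auto simp: ennreal_neg intro: upper_ge)
    next
      case 2
      then show ?thesis using C by (auto simp: ennreal_neg intro: upper_ge)
    next
      case 3
      have "C \<inter> D = {}" using disj C(2) D(2) by blast
      then have "m (C \<union> D) = m C + m D" by (intro m_Un C(1) D(1))
      then have "ennreal (m C) + ennreal (m D) = ennreal (m (C \<union> D))" using 3 by (simp add: ennreal_plus)
      also have "\<dots> \<le> upper (A \<union> B)" using C D by (intro upper_ge) auto
      finally show ?thesis .
    qed
  qed
  let ?S = "\<lambda>A. {C \<in> sets borel. C \<subseteq> (A :: 'g set)}"
  have ne: "?S A \<noteq> {}" for A by auto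
  have "upper A + upper B = (SUP D\<in>?S B. upper A + ennreal (m D))"
    unfolding upper_def[of B] using ne by (simp add: ennreal_SUP_add_right)
  also have "\<dots> = (SUP D\<in>?S B. SUP C\<in>?S A. ennreal (m C) + ennreal (m D))"
    unfolding upper_def[of A] using ne by (simp add: ennreal_SUP_add_left)
  also have "\<dots> \<le> upper (A \<union> B)" using le by (intro SUP_least) auto
  finally show ?thesis .
qed

lemma upper_sum_le:
  fixes A :: "nat \<Rightarrow> 'g set"
  assumes "disjoint_family A"
  shows "(\<Sum>i<n. upper (A i)) \<le> upper (\<Union>i<n. A i)"
proof (induction n)
  case 0
  then show ?case by simp
next
  case (Suc n)
  have "A i \<inter> A n = {}" if "i < n" for i
    using assms that by (simp add: disjoint_family_on_def)
  then have "(\<Union>i<n. A i) \<inter> A n = {}" by blast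
  from upper_superadditive[OF this]
  have "upper (\<Union>i<n. A i) + upper (A n) \<le> upper (\<Union>i<Suc n. A i)"
    by (simp add: lessThan_Suc Un_commute)
  moreover have "(\<Sum>i<Suc n. upper (A i)) \<le> upper (\<Union>i<n. A i) + upper (A n)"
    using Suc by (simp add: add_right_mono)
  ultimately show ?case by (rule order_trans[rotated])
qed

text \<open>Cutting a set \<open>B\<close> along the \<open>A\<^sub>i\<close> and using the \<open>\<sigma>\<close>-additivity of \<open>m\<close> gives
  subadditivity; joining near-optimal subsets of finitely many disjoint \<open>A\<^sub>i\<close> gives
  superadditivity.\<close>

lemma upper_countably_additive: "countably_additive (sets borel) upper"
proof (rule countably_additiveI)
  fix A :: "nat \<Rightarrow> 'g set"
  assume A: "range A \<subseteq> sets borel" and disj: "disjoint_family A"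
  show "(\<Sum>i. upper (A i)) = upper (\<Union>i. A i)"
  proof (rule antisym)
    have "(\<Sum>i<n. upper (A i)) \<le> upper (\<Union>i. A i)" for n
      using upper_sum_le[OF disj, of n] by (rule order_trans) (intro upper_mono, auto)
    then show "(\<Sum>i. upper (A i)) \<le> upper (\<Union>i. A i)"
      by (simp add: suminf_eq_SUP SUP_least)
    show "upper (\<Union>i. A i) \<le> (\<Sum>i. upper (A i))"
      unfolding upper_def[of "\<Union>i. A i"]
    proof (rule SUP_least)
      fix B assume "B \<in> {B \<in> sets borel. B \<subseteq> (\<Union>i. A i)}"
      then have B: "B \<in> sets borel" "B \<subseteq> (\<Union>i. A i)" by auto
      have Ai: "A i \<in> sets borel" for i using A by auto
      have "(\<lambda>i. m (B \<inter> A i)) sums m (\<Union>i. B \<inter> A i)"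
        using B Ai disj by (intro sigma_additive) (auto simp: disjoint_family_on_def, blast)
      moreover have "(\<Union>i. B \<inter> A i) = B" using B(2) by auto
      ultimately have "(\<lambda>n. \<Sum>i<n. m (B \<inter> A i)) \<longlonglongrightarrow> m B" by (simp add: sums_def)
      then have "(\<lambda>n. ennreal (\<Sum>i<n. m (B \<inter> A i))) \<longlonglongrightarrow> ennreal (m B)" by (rule tendsto_ennrealI)
      moreover have "ennreal (\<Sum>i<n. m (B \<inter> A i)) \<le> (\<Sum>i. upper (A i))" for n
      proof -
        have "ennreal (\<Sum>i<n. m (B \<inter> A i)) \<le> ennreal (\<Sum>i<n. max 0 (m (B \<inter> A i)))"
          by (intro ennreal_leI sum_mono) simp
        also have "\<dots> = (\<Sum>i<n. ennreal (max 0 (m (B \<inter> A i))))"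
          by (simp add: sum_ennreal)
        also have "\<dots> \<le> (\<Sum>i<n. upper (A i))"
        proof (rule sum_mono)
          fix i
          show "ennreal (max 0 (m (B \<inter> A i))) \<le> upper (A i)"
            using upper_ge[of "B \<inter> A i" "A i"] B(1) Ai[of i] by (auto simp: max_def ennreal_neg)
        qed
        also have "\<dots> \<le> (\<Sum>i. upper (A i))" by (simp add: sum_le_suminf)
        finally show ?thesis .
      qed
      ultimately show "ennreal (m B) \<le> (\<Sum>i. upper (A i))"
        by (intro LIMSEQ_le_const2) auto
    qed
  qed
qed

lemma sets_upper_variation: "sets (upper_variation m) = sets borel"
  unfolding upper_variation_def using sets.sets_measure_of_eq[of borel] by simp

lemma space_upper_variation: "space (upper_variation m) = UNIV"
  using sets_eq_imp_space_eq[OF sets_upper_variation] by simp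

lemma emeasure_upper_variation:
  assumes A: "A \<in> sets borel"
  shows "emeasure (upper_variation m) A = upper A"
  unfolding upper_variation_def upper_def[symmetric]
proof (rule emeasure_measure_of_sigma)
  show "sigma_algebra UNIV (sets (borel :: 'g measure))"
    using sets.sigma_algebra_axioms[of borel] by simp
  show "positive (sets borel) upper" by (simp add: positive_def upper_empty)
qed (use upper_countably_additive A in auto)

lemma finite_measure_upper_variation: "finite_measure (upper_variation m)"
  by (rule finite_measureI)
    (use upper_finite[of UNIV] in \<open>simp add: space_upper_variation emeasure_upper_variation\<close>)

text \<open>For \<open>B \<subseteq> A\<close> one has \<open>m(B) = m(A) - m(A - B)\<close>; take the supremum over \<open>B\<close>.\<close>

lemma upper_variation_le:
  assumes A: "A \<in> sets borel"
  shows "measure (upper_variation m) A \<le> m A + measure (upper_variation (\<lambda>A. - m A)) A"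
proof -
  interpret neg: finite_signed_measure "\<lambda>A. - m A" by (rule finite_signed_measure_minus)
  interpret Neg: finite_measure "upper_variation (\<lambda>A. - m A)" by (rule neg.finite_measure_upper_variation)
  interpret Pos: finite_measure "upper_variation m" by (rule finite_measure_upper_variation)
  let ?V = "measure (upper_variation (\<lambda>A. - m A)) A"
  have le: "m B \<le> m A + ?V" if B: "B \<in> sets borel" "B \<subseteq> A" for B
  proof -
    have "ennreal (- m (A - B)) \<le> ennreal ?V"
      using neg.upper_ge[of "A - B" A] A B
      by (simp add: neg.emeasure_upper_variation[symmetric] Neg.emeasure_eq_measure)
    then have "- m (A - B) \<le> ?V" by (cases "0 \<le> - m (A - B)") (auto intro: order_trans)
    then show ?thesis using m_Diff[OF B(1) A B(2)] by simp
  qed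
  have "upper A \<le> ennreal (m A + ?V)"
    unfolding upper_def using le by (intro SUP_least ennreal_leI) auto
  then show ?thesis
    using le[of "{}"] by (simp add: emeasure_upper_variation[OF A, symmetric] Pos.emeasure_eq_measure m_empty)
qed

lemma jordan_decomposition:
  assumes A: "A \<in> sets borel"
  shows "measure (upper_variation m) A - measure (upper_variation (\<lambda>A. - m A)) A = m A"
proof -
  interpret neg: finite_signed_measure "\<lambda>A. - m A" by (rule finite_signed_measure_minus)
  show ?thesis using upper_variation_le[OF A] neg.upper_variation_le[OF A] by simp
qed

end

subsection \<open>Simple functions\<close>

lemma vector_measures_scalar_sums:
  assumes \<mu>: "\<mu> \<in> vector_measures scalar_field" and A: "range A \<subseteq> sets borel" "disjoint_family A"
  shows "(\<lambda>i. \<mu> (A i)) sums \<mu> (\<Union>i. A i)"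
  using scalar_field.vector_measure_sigma_additive[OF \<mu> A]
  unfolding sums_def by (simp add: tendsto_norm_zero_iff LIM_zero_iff)

lemma finite_signed_measures:
  assumes \<mu>: "\<mu> \<in> vector_measures scalar_field"
  shows "finite_signed_measure (\<lambda>A. Re (\<mu> A))" "finite_signed_measure (\<lambda>A. Im (\<mu> A))"
proof -
  obtain K where K: "\<And>A. nrm scalar_field (\<mu> A) \<le> K"
    using scalar_field.vector_measure_bounded[OF \<mu>] by blast
  have "\<bar>Re (\<mu> A)\<bar> \<le> K \<and> \<bar>Im (\<mu> A)\<bar> \<le> K" for A
    using K[of A] abs_Re_le_cmod[of "\<mu> A"] abs_Im_le_cmod[of "\<mu> A"] by simp
  then show "finite_signed_measure (\<lambda>A. Re (\<mu> A))" "finite_signed_measure (\<lambda>A. Im (\<mu> A))"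
    using vector_measures_scalar_sums[OF \<mu>]
    by (auto simp: finite_signed_measure_def intro: sums_Re sums_Im)
qed

definition parts :: "('g::topological_space set \<Rightarrow> complex) \<Rightarrow> 'g measure set" where
  "parts \<mu> = {upper_variation (\<lambda>A. Re (\<mu> A)), upper_variation (\<lambda>A. - Re (\<mu> A)),
    upper_variation (\<lambda>A. Im (\<mu> A)), upper_variation (\<lambda>A. - Im (\<mu> A))}"

lemma parts_finite_borel:
  assumes \<mu>: "\<mu> \<in> vector_measures scalar_field" and M: "M \<in> parts \<mu>"
  shows "finite_measure M" "sets M = sets borel" "space M = UNIV"
proof -
  note fsm = finite_signed_measures[OF \<mu>]
  note all = fsm fsm[THEN finite_signed_measure.finite_signed_measure_minus]
  show "finite_measure M" "sets M = sets borel" "space M = UNIV"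
    using M all[THEN finite_signed_measure.finite_measure_upper_variation]
      all[THEN finite_signed_measure.sets_upper_variation]
      all[THEN finite_signed_measure.space_upper_variation]
    unfolding parts_def by auto
qed

definition bounded_borel :: "('g::topological_space \<Rightarrow> complex) \<Rightarrow> bool" where
  "bounded_borel f \<longleftrightarrow> f \<in> borel_measurable borel \<and> bounded (range f)"

lemma bounded_borelI: "f \<in> borel_measurable borel \<Longrightarrow> (\<And>t. cmod (f t) \<le> K) \<Longrightarrow> bounded_borel f"
  unfolding bounded_borel_def bounded_iff by auto

lemma bounded_borel_diff:
  assumes f: "bounded_borel f" and g: "bounded_borel g"
  shows "bounded_borel (\<lambda>t. f t - g t)"
proof -
  obtain K L where "\<And>t. cmod (f t) \<le> K" "\<And>t. cmod (g t) \<le> L"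
    using f g unfolding bounded_borel_def bounded_iff by auto
  then have "cmod (f t - g t) \<le> K + L" for t
    using norm_triangle_ineq4[of "f t" "g t"] add_mono order_trans by meson
  then show ?thesis using f g by (intro bounded_borelI) (auto simp: bounded_borel_def)
qed

lemma bounded_borel_integrable:
  assumes \<mu>: "\<mu> \<in> vector_measures scalar_field" and M: "M \<in> parts \<mu>" and f: "bounded_borel f"
  shows "integrable M f"
proof -
  obtain K where K: "\<And>t. cmod (f t) \<le> K" using f unfolding bounded_borel_def bounded_iff by auto
  have "f \<in> borel_measurable M"
    using f measurable_cong_sets[OF parts_finite_borel(2)[OF \<mu> M] refl] by (auto simp: bounded_borel_def)
  then show ?thesis
    by (intro finite_measure.integrable_const_bound[where B = K] parts_finite_borel(1)[OF \<mu> M] AE_I2 K)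
qed

lemma complex_measure_integral_diff:
  assumes \<mu>: "\<mu> \<in> vector_measures scalar_field" and f: "bounded_borel f" and g: "bounded_borel g"
  shows "complex_measure_integral \<mu> (\<lambda>t. f t - g t) = complex_measure_integral \<mu> f - complex_measure_integral \<mu> g"
proof -
  have int: "(\<integral>t. f t - g t \<partial>M) = integral\<^sup>L M f - integral\<^sup>L M g" if "M \<in> parts \<mu>" for M
    by (intro Bochner_Integration.integral_diff bounded_borel_integrable[OF \<mu> that] f g)
  note four = int[of "upper_variation (\<lambda>A. Re (\<mu> A))"] int[of "upper_variation (\<lambda>A. - Re (\<mu> A))"]
    int[of "upper_variation (\<lambda>A. Im (\<mu> A))"] int[of "upper_variation (\<lambda>A. - Im (\<mu> A))"]
  show ?thesis
    unfolding complex_measure_integral_def four[unfolded parts_def, simplified]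
    by (simp add: algebra_simps)
qed

text \<open>The constant comes from the masses of the positive parts of \<open>\<mu>\<close>. It only serves to pass to
  uniform limits; the sharp constant is the total variation, obtained below through simple
  functions.\<close>

lemma complex_measure_integral_crude_bound:
  assumes \<mu>: "\<mu> \<in> vector_measures scalar_field"
  obtains C where "0 \<le> C"
    "\<And>f K. bounded_borel f \<Longrightarrow> (\<And>t. cmod (f t) \<le> K) \<Longrightarrow> cmod (complex_measure_integral \<mu> f) \<le> C * K"
proof -
  let ?U = "\<lambda>h. upper_variation (\<lambda>A. h (\<mu> A))"
  let ?C = "\<lambda>h. measure (?U h) UNIV"
  have le: "cmod (integral\<^sup>L M f) \<le> measure M UNIV * K"
    if M: "M \<in> parts \<mu>" and f: "bounded_borel f" and K: "\<And>t. cmod (f t) \<le> K" for f M K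
  proof -
    interpret finite_measure M by (rule parts_finite_borel(1)[OF \<mu> M])
    have "cmod (integral\<^sup>L M f) \<le> (\<integral>t. cmod (f t) \<partial>M)" by (rule integral_norm_bound)
    also have "\<dots> \<le> (\<integral>t. K \<partial>M)"
      using bounded_borel_integrable[OF \<mu> M f] K by (intro integral_mono) auto
    also have "\<dots> = measure M UNIV * K" by (simp add: parts_finite_borel(3)[OF \<mu> M])
    finally show ?thesis .
  qed
  define C where "C = (\<Sum>M\<in>parts \<mu>. 4 * measure M UNIV)"
  have C: "4 * measure M UNIV \<le> C" if "M \<in> parts \<mu>" for M
    unfolding C_def using that by (intro member_le_sum) (auto simp: parts_def)
  have "0 \<le> C" unfolding C_def by (intro sum_nonneg) auto
  moreover have "cmod (complex_measure_integral \<mu> f) \<le> C * K"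
    if f: "bounded_borel f" and K: "\<And>t. cmod (f t) \<le> K" for f K
  proof -
    have "0 \<le> K" using K[of undefined] norm_ge_zero order_trans by blast
    then have "4 * cmod (integral\<^sup>L M f) \<le> C * K" if "M \<in> parts \<mu>" for M
      using le[OF that f K] mult_right_mono[OF C[OF that]] by fastforce
    then have four: "4 * cmod (integral\<^sup>L (?U Re) f) \<le> C * K"
        "4 * cmod (integral\<^sup>L (?U (\<lambda>z. - Re z)) f) \<le> C * K"
        "4 * cmod (integral\<^sup>L (?U Im) f) \<le> C * K"
        "4 * cmod (integral\<^sup>L (?U (\<lambda>z. - Im z)) f) \<le> C * K"
      by (simp_all add: parts_def)
    have "cmod ((a - b) + \<i> * (c - d)) \<le> cmod a + cmod b + cmod c + cmod d" for a b c d
    proof -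
      have "cmod ((a - b) + \<i> * (c - d)) \<le> cmod (a - b) + cmod (c - d)"
        using norm_triangle_ineq[of "a - b" "\<i> * (c - d)"] by (simp add: norm_mult)
      then show ?thesis using norm_triangle_ineq4[of a b] norm_triangle_ineq4[of c d] by linarith
    qed
    then show ?thesis unfolding complex_measure_integral_def using four by (smt (verit))
  qed
  ultimately show thesis by (rule that)
qed

definition simple_borel :: "('g::topological_space \<Rightarrow> complex) \<Rightarrow> bool" where
  "simple_borel g \<longleftrightarrow> g \<in> borel_measurable borel \<and> finite (range g)"

lemma simple_borel_bounded: "simple_borel g \<Longrightarrow> bounded_borel g"
  by (simp add: simple_borel_def bounded_borel_def finite_imp_bounded)

lemma simple_borel_fibre: "simple_borel g \<Longrightarrow> g -` {c} \<in> sets borel"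
  using measurable_sets[of g borel borel "{c}"] by (simp add: simple_borel_def)

lemma integral_simple_borel:
  assumes M: "finite_measure M" "sets M = sets borel" "space M = UNIV" and g: "simple_borel g"
  shows "integral\<^sup>L M g = (\<Sum>c\<in>range g. c * of_real (measure M (g -` {c})))"
proof -
  interpret finite_measure M by (rule M(1))
  have fin: "finite (range g)" using g by (simp add: simple_borel_def)
  have fib: "g -` {c} \<in> sets M" for c using simple_borel_fibre[OF g] M(2) by simp
  have hbi: "has_bochner_integral M (\<lambda>t. indicator (g -` {c}) t *\<^sub>R c) (measure M (g -` {c}) *\<^sub>R c)" for c
    by (rule has_bochner_integral_indicator) (use fib in \<open>auto simp: emeasure_eq_measure\<close>)
  have "has_bochner_integral M (\<lambda>t. \<Sum>c\<in>range g. indicator (g -` {c}) t *\<^sub>R c)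
      (\<Sum>c\<in>range g. measure M (g -` {c}) *\<^sub>R c)"
    by (intro has_bochner_integral_sum hbi)
  moreover have "(\<Sum>c\<in>range g. indicator (g -` {c}) t *\<^sub>R c) = g t" for t
  proof -
    have "(\<Sum>c\<in>range g. indicator (g -` {c}) t *\<^sub>R c) = (\<Sum>c\<in>range g. if c = g t then c else 0)"
      by (intro sum.cong) (auto simp: indicator_def)
    then show ?thesis using fin by simp
  qed
  ultimately show ?thesis
    by (simp add: has_bochner_integral_integral_eq scaleR_conv_of_real mult.commute)
qed

lemma complex_measure_integral_simple:
  assumes \<mu>: "\<mu> \<in> vector_measures scalar_field" and g: "simple_borel g"
  shows "complex_measure_integral \<mu> g = (\<Sum>c\<in>range g. c * \<mu> (g -` {c}))"
proof -
  note fsm = finite_signed_measures[OF \<mu>]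
  have int: "integral\<^sup>L M g = (\<Sum>c\<in>range g. c * of_real (measure M (g -` {c})))" if "M \<in> parts \<mu>" for M
    by (intro integral_simple_borel parts_finite_borel[OF \<mu> that] g)
  have "complex_measure_integral \<mu> g = (\<Sum>c\<in>range g. c * of_real (Re (\<mu> (g -` {c})))) +
      \<i> * (\<Sum>c\<in>range g. c * of_real (Im (\<mu> (g -` {c}))))"
    unfolding complex_measure_integral_def
    by (simp add: int parts_def sum_subtractf[symmetric] right_diff_distrib[symmetric]
        of_real_diff[symmetric] fsm[THEN finite_signed_measure.jordan_decomposition]
        simple_borel_fibre[OF g] del: of_real_diff)
  also have "\<dots> = (\<Sum>c\<in>range g. c * \<mu> (g -` {c}))"
    unfolding sum_distrib_left sum.distrib[symmetric]
    by (intro sum.cong refl) (simp add: complex_eq_iff algebra_simps)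
  finally show ?thesis .
qed

subsection \<open>Uniform approximation\<close>

text \<open>Round the real and imaginary parts down to multiples of \<open>1 / (n + 1)\<close>.\<close>

lemma bounded_borel_approx:
  assumes f: "bounded_borel f"
  obtains g where "\<And>n. simple_borel (g n)" "\<And>n t. cmod (f t - g n t) \<le> 2 / real (Suc n)"
proof -
  obtain K where K: "\<And>t. cmod (f t) \<le> K" using f unfolding bounded_borel_def bounded_iff by auto
  have [measurable]: "f \<in> borel_measurable borel" using f by (simp add: bounded_borel_def)
  define r :: "nat \<Rightarrow> real \<Rightarrow> real" where "r n x = of_int \<lfloor>real (Suc n) * x\<rfloor> / real (Suc n)" for n x
  define g where "g n t = Complex (r n (Re (f t))) (r n (Im (f t)))" for n t
  have r: "\<bar>x - r n x\<bar> \<le> 1 / real (Suc n)" for n x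
  proof -
    have "\<bar>real (Suc n) * x - of_int \<lfloor>real (Suc n) * x\<rfloor>\<bar> \<le> 1" by linarith
    then have "\<bar>real (Suc n) * (x - r n x)\<bar> \<le> 1" by (simp add: r_def right_diff_distrib del: of_nat_Suc)
    then have "real (Suc n) * \<bar>x - r n x\<bar> \<le> 1" by (simp only: abs_mult abs_of_nat)
    then show ?thesis by (simp add: pos_le_divide_eq mult.commute del: of_nat_Suc)
  qed
  have "simple_borel (g n)" for n
  proof -
    have "g n = (\<lambda>t. of_real (r n (Re (f t))) + \<i> * of_real (r n (Im (f t))))"
      by (auto simp: g_def complex_eq_iff)
    then have "g n \<in> borel_measurable borel" by (simp add: r_def)
    moreover have "finite (range (g n))"
    proof (rule finite_subset)
      define Z where "Z = {\<lfloor>- real (Suc n) * K\<rfloor>..\<lfloor>real (Suc n) * K\<rfloor>}"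
      have "\<lfloor>real (Suc n) * x\<rfloor> \<in> Z" if "\<bar>x\<bar> \<le> K" for x
      proof -
        have "real (Suc n) * x \<le> real (Suc n) * K" "real (Suc n) * (- K) \<le> real (Suc n) * x"
          using that by (intro mult_left_mono; simp)+
        then show ?thesis unfolding Z_def by (auto intro!: floor_mono simp del: of_nat_Suc)
      qed
      then show "range (g n) \<subseteq> (\<lambda>(i, j). Complex (of_int i / real (Suc n)) (of_int j / real (Suc n))) ` (Z \<times> Z)"
        unfolding g_def r_def
        using abs_Re_le_cmod abs_Im_le_cmod K order_trans
        by (auto simp del: of_nat_Suc intro!: image_eqI[where x = "(_, _)"]; blast)
      show "finite ((\<lambda>(i, j). Complex (of_int i / real (Suc n)) (of_int j / real (Suc n))) ` (Z \<times> Z))"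
        by (simp add: Z_def)
    qed
    ultimately show ?thesis by (simp add: simple_borel_def)
  qed
  moreover have "cmod (f t - g n t) \<le> 2 / real (Suc n)" for n t
    using cmod_le[of "f t - g n t"] r[of "Re (f t)" n] r[of "Im (f t)" n] by (simp add: g_def)
  ultimately show thesis by (rule that)
qed

lemma inverse_Suc_tendsto_zero: "(\<lambda>n. C * (2 / real (Suc n))) \<longlonglongrightarrow> 0"
  using tendsto_mult_left[OF LIMSEQ_inverse_real_of_nat, of "2 * C"] by (simp add: field_simps)

lemma complex_measure_integral_tendsto:
  assumes \<mu>: "\<mu> \<in> vector_measures scalar_field" and f: "bounded_borel f"
    and g: "\<And>n. simple_borel (g n)" "\<And>n t. cmod (f t - g n t) \<le> 2 / real (Suc n)"
  shows "(\<lambda>n. \<Sum>c\<in>range (g n). c * \<mu> (g n -` {c})) \<longlonglongrightarrow> complex_measure_integral \<mu> f"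
proof -
  obtain C where C: "\<And>f K. bounded_borel f \<Longrightarrow> (\<And>t. cmod (f t) \<le> K) \<Longrightarrow>
      cmod (complex_measure_integral \<mu> f) \<le> C * K"
    using complex_measure_integral_crude_bound[OF \<mu>] by metis
  have "cmod (complex_measure_integral \<mu> (g n) - complex_measure_integral \<mu> f) \<le> C * (2 / real (Suc n))" for n
  proof -
    have gn: "bounded_borel (g n)" by (rule simple_borel_bounded[OF g(1)])
    have "cmod (complex_measure_integral \<mu> (\<lambda>t. f t - g n t)) \<le> C * (2 / real (Suc n))"
      by (intro C bounded_borel_diff f gn g(2))
    then show ?thesis by (simp add: complex_measure_integral_diff[OF \<mu> f gn] norm_minus_commute)
  qed
  then have "(\<lambda>n. complex_measure_integral \<mu> (g n) - complex_measure_integral \<mu> f) \<longlonglongrightarrow> 0"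
    by (intro Lim_null_comparison[OF always_eventually inverse_Suc_tendsto_zero[of C]] allI)
  then show ?thesis by (simp add: LIM_zero_iff complex_measure_integral_simple[OF \<mu> g(1)])
qed

text \<open>The Jordan decomposition is not additive in the measure, so additivity is read off from the
  integrals of simple functions, which are finite sums of values of the measure.\<close>

lemma complex_measure_integral_add:
  assumes \<mu>1: "\<mu>1 \<in> vector_measures scalar_field" and \<mu>2: "\<mu>2 \<in> vector_measures scalar_field"
    and \<mu>: "(\<lambda>A. \<mu>1 A + \<mu>2 A) \<in> vector_measures scalar_field" and f: "bounded_borel f"
  shows "complex_measure_integral (\<lambda>A. \<mu>1 A + \<mu>2 A) f =
    complex_measure_integral \<mu>1 f + complex_measure_integral \<mu>2 f"
proof -
  obtain g where g: "\<And>n. simple_borel (g n)" "\<And>n t. cmod (f t - g n t) \<le> 2 / real (Suc n)"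
    by (rule bounded_borel_approx[OF f]) blast
  note lim = complex_measure_integral_tendsto[OF _ f g]
  show ?thesis
    using LIMSEQ_unique[OF lim[OF \<mu>]] tendsto_add[OF lim[OF \<mu>1] lim[OF \<mu>2]]
    by (simp add: distrib_left sum.distrib)
qed

lemma complex_measure_integral_scal:
  assumes \<mu>: "\<mu> \<in> vector_measures scalar_field" and a\<mu>: "(\<lambda>A. a * \<mu> A) \<in> vector_measures scalar_field"
    and f: "bounded_borel f"
  shows "complex_measure_integral (\<lambda>A. a * \<mu> A) f = a * complex_measure_integral \<mu> f"
proof -
  obtain g where g: "\<And>n. simple_borel (g n)" "\<And>n t. cmod (f t - g n t) \<le> 2 / real (Suc n)"
    by (rule bounded_borel_approx[OF f]) blast
  note lim = complex_measure_integral_tendsto[OF _ f g]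
  show ?thesis
    using LIMSEQ_unique[OF lim[OF a\<mu>]] tendsto_mult_left[OF lim[OF \<mu>], of a]
    by (simp add: sum_distrib_left mult.left_commute)
qed

text \<open>The fibres of a simple function form a partition that is admissible for the total
  variation.\<close>

lemma simple_total_variation_bound:
  assumes \<mu>: "\<mu> \<in> vector_measures scalar_field" and g: "simple_borel g" and K: "\<And>t. cmod (g t) \<le> K"
  shows "cmod (\<Sum>c\<in>range g. c * \<mu> (g -` {c})) \<le> K * enn2real (total_variation \<mu> UNIV)"
proof -
  have fin: "finite (range g)" using g by (simp add: simple_borel_def)
  let ?P = "(\<lambda>c. g -` {c}) ` range g"
  have inj: "inj_on (\<lambda>c. g -` {c}) (range g)" by (auto simp: inj_on_def)
  have "partition_on UNIV ?P"
    by (rule partition_onI) (auto simp: disjnt_def)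
  then have "(\<Sum>B\<in>?P. ennreal (cmod (\<mu> B))) \<le> total_variation \<mu> UNIV"
    unfolding total_variation_def using fin simple_borel_fibre[OF g] by (intro SUP_upper) auto
  also have "(\<Sum>B\<in>?P. ennreal (cmod (\<mu> B))) = ennreal (\<Sum>c\<in>range g. cmod (\<mu> (g -` {c})))"
    by (simp add: sum.reindex[OF inj] sum_ennreal)
  finally have "enn2real (ennreal (\<Sum>c\<in>range g. cmod (\<mu> (g -` {c})))) \<le> enn2real (total_variation \<mu> UNIV)"
    using total_variation_finite[OF \<mu>] by (intro enn2real_mono) auto
  then have tv: "(\<Sum>c\<in>range g. cmod (\<mu> (g -` {c}))) \<le> enn2real (total_variation \<mu> UNIV)"
    by (simp add: sum_nonneg)
  have "0 \<le> K" using K[of undefined] norm_ge_zero order_trans by blast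
  have "cmod (\<Sum>c\<in>range g. c * \<mu> (g -` {c})) \<le> (\<Sum>c\<in>range g. K * cmod (\<mu> (g -` {c})))"
    using K by (intro sum_norm_le) (auto simp: norm_mult intro!: mult_right_mono)
  also have "\<dots> \<le> K * enn2real (total_variation \<mu> UNIV)"
    using mult_left_mono[OF tv \<open>0 \<le> K\<close>] by (simp add: sum_distrib_left)
  finally show ?thesis .
qed

theorem complex_measure_integral_bound:
  assumes \<mu>: "\<mu> \<in> vector_measures scalar_field" and f: "f \<in> borel_measurable borel"
    and K: "\<And>t. cmod (f t) \<le> K"
  shows "cmod (complex_measure_integral \<mu> f) \<le> K * enn2real (total_variation \<mu> UNIV)"
proof -
  have bf: "bounded_borel f" by (rule bounded_borelI[OF f K])
  obtain g where g: "\<And>n. simple_borel (g n)" "\<And>n t. cmod (f t - g n t) \<le> 2 / real (Suc n)"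
    by (rule bounded_borel_approx[OF bf]) blast
  let ?V = "enn2real (total_variation \<mu> UNIV)"
  have "cmod (g n t) \<le> K + 2 / real (Suc n)" for n t
    using norm_triangle_ineq2[of "g n t" "f t"] g(2)[of t n] K[of t] by (simp add: norm_minus_commute)
  then have "cmod (\<Sum>c\<in>range (g n). c * \<mu> (g n -` {c})) \<le> (K + 2 / real (Suc n)) * ?V" for n
    by (intro simple_total_variation_bound[OF \<mu> g(1)])
  then have le: "cmod (\<Sum>c\<in>range (g n). c * \<mu> (g n -` {c})) \<le> K * ?V + ?V * (2 / real (Suc n))" for n
    by (simp only: distrib_right mult.commute[of ?V])
  have "(\<lambda>n. K * ?V + ?V * (2 / real (Suc n))) \<longlonglongrightarrow> K * ?V + 0"
    by (intro tendsto_add tendsto_const inverse_Suc_tendsto_zero)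
  then show ?thesis
    using LIMSEQ_le[OF tendsto_norm[OF complex_measure_integral_tendsto[OF \<mu> bf g]]] le by auto
qed

section \<open>Integration against vector measures\<close>

definition weak_integral ::
    "('e::ab_group_add, 'm) cnormed_scheme \<Rightarrow> ('g::topological_space set \<Rightarrow> 'e) \<Rightarrow> ('g \<Rightarrow> complex) \<Rightarrow> 'e \<Rightarrow> bool"
  where "weak_integral E \<nu> f x \<longleftrightarrow>
    x \<in> vecs E \<and> (\<forall>\<phi>\<in>dual E. \<phi> x = complex_measure_integral (\<lambda>A. \<phi> (\<nu> A)) f)"

context complex_normed_space
begin

lemma weak_integral_mem: "weak_integral E \<nu> f x \<Longrightarrow> x \<in> vecs E"
  by (simp add: weak_integral_def)

text \<open>The dual separates points, so the definite description in \<^const>\<open>vector_integral\<close> is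
  determined as soon as one weak integral is known.\<close>

lemma vector_integral_eq:
  assumes x: "weak_integral E \<nu> f x"
  shows "vector_integral E \<nu> f = x"
  unfolding vector_integral_def
proof (rule the_equality)
  show "x \<in> vecs E \<and> (\<forall>\<phi>\<in>dual E. \<phi> x = complex_measure_integral (\<lambda>A. \<phi> (\<nu> A)) f)"
    using x by (simp add: weak_integral_def)
  show "y = x" if "y \<in> vecs E \<and> (\<forall>\<phi>\<in>dual E. \<phi> y = complex_measure_integral (\<lambda>A. \<phi> (\<nu> A)) f)" for y
    using that x unfolding weak_integral_def by (intro dual_separates) auto
qed

lemma weak_integral_simple:
  assumes \<nu>: "\<nu> \<in> vector_measures E" and g: "simple_borel g"
  shows "weak_integral E \<nu> g (\<Sum>c\<in>range g. scal E c (\<nu> (g -` {c})))"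
  unfolding weak_integral_def
proof (intro conjI ballI sum_mem scal_mem vector_measure_mem[OF \<nu>])
  fix \<phi> assume \<phi>: "\<phi> \<in> dual E"
  show "\<phi> (\<Sum>c\<in>range g. scal E c (\<nu> (g -` {c}))) = complex_measure_integral (\<lambda>A. \<phi> (\<nu> A)) g"
    by (simp add: complex_measure_integral_simple[OF dual_compose_vector_measure[OF \<phi> \<nu>] g]
        dual_sum[OF \<phi>] dual_scal[OF \<phi>] scal_mem vector_measure_mem[OF \<nu>])
qed

lemma weak_integral_diff:
  assumes \<nu>: "\<nu> \<in> vector_measures E" and f: "bounded_borel f" and g: "bounded_borel g"
    and x: "weak_integral E \<nu> f x" and y: "weak_integral E \<nu> g y"
  shows "weak_integral E \<nu> (\<lambda>t. f t - g t) (x - y)"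
  using x y unfolding weak_integral_def
  by (auto simp: diff_mem dual_diff
      complex_measure_integral_diff[OF dual_compose_vector_measure[OF _ \<nu>] f g])

text \<open>A norming functional reduces this to the bound of a scalar integral by the total variation,
  which is the step where the semivariation appears.\<close>

theorem nrm_weak_integral_le:
  assumes \<nu>: "\<nu> \<in> vector_measures E" and f: "f \<in> borel_measurable borel" and K: "\<And>t. cmod (f t) \<le> K"
    and x: "weak_integral E \<nu> f x"
  shows "nrm E x \<le> K * enn2real (semivariation E \<nu>)"
proof (rule nrm_le_via_dual_ball[OF weak_integral_mem[OF x]])
  fix \<phi> assume \<phi>: "\<phi> \<in> dual_ball E"
  have "0 \<le> K" using K[of undefined] norm_ge_zero order_trans by blast
  have "total_variation (\<lambda>A. \<phi> (\<nu> A)) UNIV \<le> semivariation E \<nu>"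
    unfolding semivariation_def by (rule SUP_upper[OF \<phi>])
  then have le: "enn2real (total_variation (\<lambda>A. \<phi> (\<nu> A)) UNIV) \<le> enn2real (semivariation E \<nu>)"
    using semivariation_finite[OF \<nu>] by (intro enn2real_mono) auto
  have "\<phi> x = complex_measure_integral (\<lambda>A. \<phi> (\<nu> A)) f"
    using x dual_ball_dual[OF \<phi>] by (simp add: weak_integral_def)
  also have "cmod \<dots> \<le> K * enn2real (total_variation (\<lambda>A. \<phi> (\<nu> A)) UNIV)"
    by (intro complex_measure_integral_bound dual_compose_vector_measure dual_ball_dual \<phi> \<nu> f K)
  also have "\<dots> \<le> K * enn2real (semivariation E \<nu>)"
    by (rule mult_left_mono[OF le \<open>0 \<le> K\<close>])
  finally show "cmod (\<phi> x) \<le> K * enn2real (semivariation E \<nu>)" .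
qed

text \<open>The integrals of simple functions that converge uniformly to \<open>f\<close> form a Cauchy sequence, by
  the bound in terms of the semivariation.\<close>

theorem weak_integral_exists:
  assumes complete: "complete_space E" and \<nu>: "\<nu> \<in> vector_measures E" and f: "bounded_borel f"
  obtains x where "weak_integral E \<nu> f x"
proof -
  obtain g where g: "\<And>n. simple_borel (g n)" "\<And>n t. cmod (f t - g n t) \<le> 2 / real (Suc n)"
    by (rule bounded_borel_approx[OF f]) blast
  define s where "s n = (\<Sum>c\<in>range (g n). scal E c (\<nu> (g n -` {c})))" for n
  define V where "V = enn2real (semivariation E \<nu>)"
  define e where "e n = V * (2 / real (Suc n))" for n
  have e: "e \<longlonglongrightarrow> 0" unfolding e_def by (rule inverse_Suc_tendsto_zero)
  have s: "weak_integral E \<nu> (g n) (s n)" for n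
    unfolding s_def by (rule weak_integral_simple[OF \<nu> g(1)])
  have bg: "bounded_borel (g n)" for n by (rule simple_borel_bounded[OF g(1)])
  have near: "nrm E (s m - s n) \<le> e m + e n" for m n
  proof -
    have "cmod (g m t - g n t) \<le> 2 / real (Suc m) + 2 / real (Suc n)" for t
      using norm_triangle_ineq4[of "f t - g n t" "f t - g m t"] g(2)[of t m] g(2)[of t n] by simp
    moreover have "(\<lambda>t. g m t - g n t) \<in> borel_measurable borel"
      using bounded_borel_diff[OF bg bg] by (simp add: bounded_borel_def)
    moreover have "weak_integral E \<nu> (\<lambda>t. g m t - g n t) (s m - s n)"
      by (rule weak_integral_diff[OF \<nu> bg bg s s])
    ultimately have "nrm E (s m - s n) \<le> (2 / real (Suc m) + 2 / real (Suc n)) * V"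
      unfolding V_def by (intro nrm_weak_integral_le[OF \<nu>])
    then show ?thesis by (simp only: e_def distrib_right mult.commute[of V])
  qed
  have cauchy: "\<exists>N. \<forall>m\<ge>N. \<forall>n\<ge>N. nrm E (s m - s n) < \<epsilon>" if "0 < \<epsilon>" for \<epsilon>
  proof -
    have "\<forall>\<^sub>F n in sequentially. e n < \<epsilon> / 2"
      using order_tendstoD(2)[OF e, of "\<epsilon> / 2"] that by simp
    then obtain N where N: "\<And>n. N \<le> n \<Longrightarrow> e n < \<epsilon> / 2"
      unfolding eventually_sequentially by blast
    have "nrm E (s m - s n) < \<epsilon>" if "N \<le> m" "N \<le> n" for m n
      using near[of m n] N[OF that(1)] N[OF that(2)] by linarith
    then show ?thesis by blast
  qed
  have "\<exists>x\<in>vecs E. (\<lambda>n. nrm E (s n - x)) \<longlonglongrightarrow> 0"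
  proof (rule complete[unfolded complete_space_def, THEN spec[where x = s], THEN mp], intro conjI allI impI)
    show "s n \<in> vecs E" for n by (rule weak_integral_mem[OF s])
    show "\<exists>N. \<forall>m\<ge>N. \<forall>n\<ge>N. nrm E (s m - s n) < \<epsilon>" if "0 < \<epsilon>" for \<epsilon>
      by (rule cauchy[OF that])
  qed
  then obtain x where x: "x \<in> vecs E" and lim: "(\<lambda>n. nrm E (s n - x)) \<longlonglongrightarrow> 0"
    by blast
  have "\<phi> x = complex_measure_integral (\<lambda>A. \<phi> (\<nu> A)) f" if \<phi>: "\<phi> \<in> dual E" for \<phi>
  proof (rule LIMSEQ_unique)
    obtain K where K: "\<And>x. x \<in> vecs E \<Longrightarrow> cmod (\<phi> x) \<le> K * nrm E x" by (rule dual_bound[OF \<phi>]) blast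
    have "cmod (\<phi> (s n) - \<phi> x) \<le> K * nrm E (s n - x)" for n
      using K[OF diff_mem[OF weak_integral_mem[OF s] x]] by (simp add: dual_diff[OF \<phi> weak_integral_mem[OF s] x])
    moreover have Klim: "(\<lambda>n. K * nrm E (s n - x)) \<longlonglongrightarrow> 0"
      using tendsto_mult_left[OF lim, of K] by simp
    ultimately have "(\<lambda>n. \<phi> (s n) - \<phi> x) \<longlonglongrightarrow> 0"
      by (intro Lim_null_comparison[OF always_eventually Klim] allI)
    then show "(\<lambda>n. \<phi> (s n)) \<longlonglongrightarrow> \<phi> x" by (simp add: LIM_zero_iff)
    have "\<phi> (s n) = (\<Sum>c\<in>range (g n). c * \<phi> (\<nu> (g n -` {c})))" for n
      unfolding s_def by (simp add: dual_sum[OF \<phi>] dual_scal[OF \<phi>] scal_mem vector_measure_mem[OF \<nu>])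
    then show "(\<lambda>n. \<phi> (s n)) \<longlonglongrightarrow> complex_measure_integral (\<lambda>A. \<phi> (\<nu> A)) f"
      using complex_measure_integral_tendsto[OF dual_compose_vector_measure[OF \<phi> \<nu>] f g] by simp
  qed
  then show thesis using x by (intro that[of x]) (simp add: weak_integral_def)
qed

lemma weak_integral_vector_integral:
  assumes "complete_space E" "\<nu> \<in> vector_measures E" "bounded_borel f"
  shows "weak_integral E \<nu> f (vector_integral E \<nu> f)"
  using weak_integral_exists[OF assms] vector_integral_eq by metis

subsection \<open>Linearity in the measure\<close>

lemma vector_measures_add:
  assumes \<nu>1: "\<nu>1 \<in> vector_measures E" and \<nu>2: "\<nu>2 \<in> vector_measures E"
  shows "(\<lambda>A. \<nu>1 A + \<nu>2 A) \<in> vector_measures E"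
proof -
  have "(\<lambda>n. nrm E ((\<Sum>i<n. \<nu>1 (A i) + \<nu>2 (A i)) - (\<nu>1 (\<Union>i. A i) + \<nu>2 (\<Union>i. A i)))) \<longlonglongrightarrow> 0"
    if A: "range A \<subseteq> sets borel" "disjoint_family A" for A :: "nat \<Rightarrow> _ set"
  proof -
    let ?r = "\<lambda>\<nu> n. (\<Sum>i<n. \<nu> (A i)) - \<nu> (\<Union>i. A i)"
    have mem: "?r \<nu>1 n \<in> vecs E" "?r \<nu>2 n \<in> vecs E" for n
      by (intro diff_mem sum_mem vector_measure_mem \<nu>1 \<nu>2)+
    have eq: "(\<Sum>i<n. \<nu>1 (A i) + \<nu>2 (A i)) - (\<nu>1 (\<Union>i. A i) + \<nu>2 (\<Union>i. A i)) = ?r \<nu>1 n + ?r \<nu>2 n" for n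
      by (simp add: sum.distrib algebra_simps)
    have lim: "(\<lambda>n. nrm E (?r \<nu>1 n) + nrm E (?r \<nu>2 n)) \<longlonglongrightarrow> 0"
      using tendsto_add[OF vector_measure_sigma_additive[OF \<nu>1 A] vector_measure_sigma_additive[OF \<nu>2 A]]
      by simp
    show ?thesis
      unfolding eq
    proof (rule Lim_null_comparison[OF always_eventually lim], rule allI)
      show "norm (nrm E (?r \<nu>1 n + ?r \<nu>2 n)) \<le> nrm E (?r \<nu>1 n) + nrm E (?r \<nu>2 n)" for n
        using nrm_triangle[OF mem] nrm_ge_0[OF add_mem[OF mem]] by simp
    qed
  qed
  then show ?thesis
    using \<nu>1 \<nu>2 unfolding vector_measures_def by (simp add: add_mem)
qed

lemma vector_measures_scal:
  assumes \<nu>: "\<nu> \<in> vector_measures E"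
  shows "(\<lambda>A. scal E a (\<nu> A)) \<in> vector_measures E"
proof -
  have "(\<lambda>n. nrm E ((\<Sum>i<n. scal E a (\<nu> (A i))) - scal E a (\<nu> (\<Union>i. A i)))) \<longlonglongrightarrow> 0"
    if A: "range A \<subseteq> sets borel" "disjoint_family A" for A :: "nat \<Rightarrow> _ set"
  proof -
    have "(\<Sum>i<n. scal E a (\<nu> (A i))) = scal E a (\<Sum>i<n. \<nu> (A i))" for n
      by (induction n) (auto simp: scal_zero_right scal_add_right sum_mem vector_measure_mem[OF \<nu>])
    then have "nrm E ((\<Sum>i<n. scal E a (\<nu> (A i))) - scal E a (\<nu> (\<Union>i. A i)))
        = cmod a * nrm E ((\<Sum>i<n. \<nu> (A i)) - \<nu> (\<Union>i. A i))" for n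
      by (simp add: scal_diff_right[symmetric] nrm_scal sum_mem diff_mem vector_measure_mem[OF \<nu>])
    then show ?thesis
      using tendsto_mult_left[OF vector_measure_sigma_additive[OF \<nu> A], of "cmod a"] by simp
  qed
  then show ?thesis
    using \<nu> unfolding vector_measures_def by (simp add: scal_mem scal_zero_right)
qed

lemma weak_integral_add_measure:
  assumes \<nu>1: "\<nu>1 \<in> vector_measures E" and \<nu>2: "\<nu>2 \<in> vector_measures E" and f: "bounded_borel f"
    and x: "weak_integral E \<nu>1 f x" and y: "weak_integral E \<nu>2 f y"
  shows "weak_integral E (\<lambda>A. \<nu>1 A + \<nu>2 A) f (x + y)"
  unfolding weak_integral_def
proof (intro conjI ballI add_mem weak_integral_mem[OF x] weak_integral_mem[OF y])
  fix \<phi> assume \<phi>: "\<phi> \<in> dual E"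
  have add: "(\<lambda>A. \<phi> (\<nu>1 A + \<nu>2 A)) = (\<lambda>A. \<phi> (\<nu>1 A) + \<phi> (\<nu>2 A))"
    by (simp add: dual_add[OF \<phi>] vector_measure_mem \<nu>1 \<nu>2)
  have "complex_measure_integral (\<lambda>A. \<phi> (\<nu>1 A) + \<phi> (\<nu>2 A)) f =
      complex_measure_integral (\<lambda>A. \<phi> (\<nu>1 A)) f + complex_measure_integral (\<lambda>A. \<phi> (\<nu>2 A)) f"
    using dual_compose_vector_measure[OF \<phi> vector_measures_add[OF \<nu>1 \<nu>2]]
    by (intro complex_measure_integral_add dual_compose_vector_measure \<phi> \<nu>1 \<nu>2 f) (simp add: add)
  then show "\<phi> (x + y) = complex_measure_integral (\<lambda>A. \<phi> (\<nu>1 A + \<nu>2 A)) f"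
    using x y \<phi> by (simp add: add dual_add weak_integral_def)
qed

lemma weak_integral_scal_measure:
  assumes \<nu>: "\<nu> \<in> vector_measures E" and f: "bounded_borel f" and x: "weak_integral E \<nu> f x"
  shows "weak_integral E (\<lambda>A. scal E a (\<nu> A)) f (scal E a x)"
  unfolding weak_integral_def
proof (intro conjI ballI scal_mem weak_integral_mem[OF x])
  fix \<phi> assume \<phi>: "\<phi> \<in> dual E"
  have scal: "(\<lambda>A. \<phi> (scal E a (\<nu> A))) = (\<lambda>A. a * \<phi> (\<nu> A))"
    by (simp add: dual_scal[OF \<phi>] vector_measure_mem \<nu>)
  have "complex_measure_integral (\<lambda>A. a * \<phi> (\<nu> A)) f = a * complex_measure_integral (\<lambda>A. \<phi> (\<nu> A)) f"
    using dual_compose_vector_measure[OF \<phi> vector_measures_scal[OF \<nu>], of a]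
    by (intro complex_measure_integral_scal[OF dual_compose_vector_measure[OF \<phi> \<nu>] _ f]) (simp add: scal)
  then show "\<phi> (scal E a x) = complex_measure_integral (\<lambda>A. \<phi> (scal E a (\<nu> A))) f"
    using x \<phi> by (simp add: scal dual_scal weak_integral_def)
qed

end

lemma complex_measure_integral_sum:
  fixes f :: "'g::topological_space \<Rightarrow> complex"
  assumes f: "bounded_borel f" and "finite I" "\<And>i. i \<in> I \<Longrightarrow> \<mu> i \<in> vector_measures scalar_field"
  shows "(\<lambda>A. \<Sum>i\<in>I. \<mu> i A) \<in> vector_measures scalar_field \<and>
    complex_measure_integral (\<lambda>A. \<Sum>i\<in>I. \<mu> i A) f = (\<Sum>i\<in>I. complex_measure_integral (\<mu> i) f)"
  using assms(2,3)
proof (induction I rule: finite_induct)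
  case empty
  have "(\<lambda>A :: 'g set. 0 :: complex) \<in> vector_measures scalar_field" by (simp add: vector_measures_def)
  then show ?case using complex_measure_integral_scal[of "\<lambda>A. 0" 0 f] f by simp
next
  case (insert j I)
  then show ?case
    using scalar_field.vector_measures_add[of "\<mu> j" "\<lambda>A. \<Sum>i\<in>I. \<mu> i A"]
      complex_measure_integral_add[OF _ _ _ f, of "\<mu> j" "\<lambda>A. \<Sum>i\<in>I. \<mu> i A"]
    by simp
qed

section \<open>Matrix norms in operator spaces\<close>

lemma sum_apply: "(\<Sum>i\<in>I. f i) x = (\<Sum>i\<in>I. f i x)"
  by (induction I rule: infinite_finite_induct) auto

lemma l2norm_nonneg: "0 \<le> l2norm v"
  by (simp add: l2norm_def sum_nonneg)

lemma scalar_mat_norm_contraction: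
  assumes \<alpha>: "\<And>v. v \<in> carrier_vec (dim_col \<alpha>) \<Longrightarrow> l2norm (\<alpha> *\<^sub>v v) \<le> l2norm v"
  shows "0 \<le> scalar_mat_norm \<alpha>" "scalar_mat_norm \<alpha> \<le> 1"
proof -
  let ?B = "{v \<in> carrier_vec (dim_col \<alpha>). l2norm v \<le> 1}"
  have zero: "0\<^sub>v (dim_col \<alpha>) \<in> ?B" by (simp add: l2norm_def)
  have le: "l2norm (\<alpha> *\<^sub>v v) \<le> 1" if "v \<in> ?B" for v
    using \<alpha>[of v] that by simp
  show "scalar_mat_norm \<alpha> \<le> 1"
    unfolding scalar_mat_norm_def using zero by (intro cSUP_least le) blast
  have "bdd_above ((\<lambda>v. l2norm (\<alpha> *\<^sub>v v)) ` ?B)"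
    using le by (intro bdd_aboveI2)
  then have "l2norm (\<alpha> *\<^sub>v 0\<^sub>v (dim_col \<alpha>)) \<le> scalar_mat_norm \<alpha>"
    unfolding scalar_mat_norm_def by (intro cSUP_upper zero)
  then show "0 \<le> scalar_mat_norm \<alpha>" using l2norm_nonneg order_trans by blast
qed

text \<open>The \<open>m \<times> n\<close> matrix whose row \<open>i\<close> is the unit row vector with index \<open>f i\<close>, or zero when
  \<open>f i \<ge> n\<close>.\<close>

definition selection :: "nat \<Rightarrow> nat \<Rightarrow> (nat \<Rightarrow> nat) \<Rightarrow> complex mat" where
  "selection m n f = mat m n (\<lambda>(i, k). if k = f i then 1 else 0)"

lemma dim_selection [simp]:
  "dim_row (selection m n f) = m" "dim_col (selection m n f) = n"
  "selection m n f \<in> carrier_mat m n"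
  by (simp_all add: selection_def)

lemma selection_contraction:
  assumes f: "inj_on f {i. i < m \<and> f i < n}" and v: "v \<in> carrier_vec n"
  shows "l2norm (selection m n f *\<^sub>v v) \<le> l2norm v"
proof -
  let ?I = "{i. i < m \<and> f i < n}"
  have entry: "(selection m n f *\<^sub>v v) $ i = (if f i < n then v $ f i else 0)" if "i < m" for i
    using v that by (simp add: selection_def scalar_prod_def if_distrib[of "\<lambda>c. c * _"] cong: if_cong)
  have "(\<Sum>i<m. (cmod ((selection m n f *\<^sub>v v) $ i))\<^sup>2) = (\<Sum>i<m. if f i < n then (cmod (v $ f i))\<^sup>2 else 0)"
    by (intro sum.cong refl) (simp add: entry del: index_mult_mat_vec)
  also have "\<dots> = (\<Sum>i\<in>?I. (cmod (v $ f i))\<^sup>2)"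
    by (rule sum.mono_neutral_cong_right) auto
  also have "\<dots> = (\<Sum>k\<in>f ` ?I. (cmod (v $ k))\<^sup>2)"
    by (simp add: sum.reindex[OF f])
  also have "\<dots> \<le> (\<Sum>k<n. (cmod (v $ k))\<^sup>2)"
    by (rule sum_mono2) auto
  finally show ?thesis
    using v by (simp add: l2norm_def selection_def)
qed

text \<open>By injectivity each entry of the product is a sum with at most one term, so squaring commutes
  with it.\<close>

lemma transpose_selection_contraction:
  assumes g: "inj_on g {j. j < m \<and> g j < n}" and v: "v \<in> carrier_vec m"
  shows "l2norm (transpose_mat (selection m n g) *\<^sub>v v) \<le> l2norm v"
proof -
  let ?J = "{j. j < m \<and> g j < n}"
  let ?S = "\<lambda>l. {j \<in> ?J. g j = l}"
  have entry: "(transpose_mat (selection m n g) *\<^sub>v v) $ l = (\<Sum>j\<in>?S l. v $ j)" if l: "l < n" for l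
  proof -
    have "(transpose_mat (selection m n g) *\<^sub>v v) $ l = (\<Sum>j\<in>{0..<m}. if l = g j then v $ j else 0)"
      using v l by (simp add: selection_def scalar_prod_def if_distrib[of "\<lambda>c. c * _"] cong: if_cong)
    also have "\<dots> = (\<Sum>j\<in>?S l. v $ j)"
      using l by (intro sum.mono_neutral_cong_right) auto
    finally show ?thesis .
  qed
  have single: "(cmod (\<Sum>j\<in>?S l. v $ j))\<^sup>2 = (\<Sum>j\<in>?S l. (cmod (v $ j))\<^sup>2)" for l
  proof (cases "?S l = {}")
    case True
    show ?thesis unfolding True by simp
  next
    case False
    then obtain j where "j \<in> ?S l" by blast
    then have "?S l = {j}" using g by (auto simp: inj_on_def)
    then show ?thesis by simp
  qed
  have "(\<Sum>l<n. (cmod ((transpose_mat (selection m n g) *\<^sub>v v) $ l))\<^sup>2)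
      = (\<Sum>l<n. \<Sum>j\<in>?S l. (cmod (v $ j))\<^sup>2)"
    by (intro sum.cong refl) (simp only: lessThan_iff entry single)
  also have "\<dots> = (\<Sum>j\<in>?J. (cmod (v $ j))\<^sup>2)"
    by (rule sum.group) auto
  also have "\<dots> \<le> (\<Sum>j<m. (cmod (v $ j))\<^sup>2)"
    by (rule sum_mono2) auto
  finally show ?thesis
    using v by (simp add: l2norm_def selection_def)
qed

definition block_diagonal :: "nat \<Rightarrow> nat \<Rightarrow> (nat \<Rightarrow> nat \<Rightarrow> nat \<Rightarrow> 'e::zero) \<Rightarrow> nat \<Rightarrow> nat \<Rightarrow> 'e" where
  "block_diagonal n k B = (\<lambda>p q.
    if p < k * n \<and> q < k * n \<and> p div n = q div n then B (p div n) (p mod n) (q mod n) else 0)"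

context operator_space
begin

lemma mats_mem: "x \<in> mats n (vecs V) \<Longrightarrow> x i j \<in> vecs V"
  using zero_mem by (cases "i < n \<and> j < n") (auto simp: mats_def)

lemma Mat_simps [simp]:
  "vecs (Mat n V) = mats n (vecs V)" "nrm (Mat n V) = mnrm V n" "scal (Mat n V) a x = (\<lambda>i j. scal V a (x i j))"
  by (simp_all add: Mat_def)

text \<open>Permuting rows and columns, deleting some and inserting zero ones amounts to multiplying by
  scalar contractions on both sides. With \<open>n = 1\<close> this bounds matrices with a single nonzero entry,
  with \<open>m = n\<close> it says that permutations do not increase the norm.\<close>

lemma mnrm_submatrix:
  assumes m: "1 \<le> m" and n: "1 \<le> n" and x: "x \<in> mats n (vecs V)"
    and f: "inj_on f {i. i < m \<and> f i < n}" and g: "inj_on g {j. j < m \<and> g j < n}"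
  shows "mnrm V m (\<lambda>i j. if i < m \<and> j < m \<and> f i < n \<and> g j < n then x (f i) (g j) else 0) \<le> mnrm V n x"
proof -
  interpret M: complex_normed_space "Mat n V" by (rule Mat_normed[OF n])
  let ?\<alpha> = "selection m n f" and ?\<beta> = "transpose_mat (selection m n g)"
  have sw: "sandwich V ?\<alpha> x ?\<beta> = (\<lambda>i j. if i < m \<and> j < m \<and> f i < n \<and> g j < n then x (f i) (g j) else 0)"
  proof (intro ext)
    fix i j
    show "sandwich V ?\<alpha> x ?\<beta> i j = (if i < m \<and> j < m \<and> f i < n \<and> g j < n then x (f i) (g j) else 0)"
    proof (cases "i < m \<and> j < m")
      case True
      then have "sandwich V ?\<alpha> x ?\<beta> i j = (\<Sum>k<n. \<Sum>l<n. if k = f i then if l = g j then x k l else 0 else 0)"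
        by (auto simp: sandwich_def selection_def scal_one scal_zero_left mats_mem[OF x] intro!: sum.cong)
      also have "\<dots> = (\<Sum>k<n. if k = f i then \<Sum>l<n. if l = g j then x k l else 0 else 0)"
        by (intro sum.cong refl) simp
      also have "\<dots> = (if f i < n \<and> g j < n then x (f i) (g j) else 0)"
        by simp
      finally show ?thesis using True by simp
    next
      case False
      then show ?thesis by (auto simp: sandwich_def selection_def)
    qed
  qed
  have \<alpha>: "0 \<le> scalar_mat_norm ?\<alpha>" "scalar_mat_norm ?\<alpha> \<le> 1"
    using scalar_mat_norm_contraction[of ?\<alpha>] selection_contraction[OF f] by simp_all
  have \<beta>: "0 \<le> scalar_mat_norm ?\<beta>" "scalar_mat_norm ?\<beta> \<le> 1"
    using scalar_mat_norm_contraction[of ?\<beta>] transpose_selection_contraction[OF g] by simp_all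
  have pos: "0 \<le> mnrm V n x" using M.nrm_ge_0[of x] x by simp
  have "mnrm V m (sandwich V ?\<alpha> x ?\<beta>) \<le> scalar_mat_norm ?\<alpha> * mnrm V n x * scalar_mat_norm ?\<beta>"
    by (rule mnrm_sandwich[OF m n _ _ x]) simp_all
  also have "\<dots> \<le> 1 * mnrm V n x * 1"
    using \<alpha> \<beta> pos by (intro mult_mono) auto
  finally show ?thesis by (simp add: sw)
qed

lemma block_diagonal_mem:
  assumes "1 \<le> n" "\<And>i. i < k \<Longrightarrow> B i \<in> mats n (vecs V)"
  shows "block_diagonal n k B \<in> mats (k * n) (vecs V)"
  using assms mats_mem[of "B _" n] zero_mem unfolding mats_def[of "k * n"] block_diagonal_def
  by (auto simp: less_mult_imp_div_less)

lemma mnrm_block_diagonal: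
  assumes n: "1 \<le> n" and k: "1 \<le> k" and B: "\<And>i. i < k \<Longrightarrow> B i \<in> mats n (vecs V)"
    and le: "\<And>i. i < k \<Longrightarrow> mnrm V n (B i) \<le> M"
  shows "mnrm V (k * n) (block_diagonal n k B) \<le> M"
  using k B le
proof (induction k rule: dec_induct)
  case base
  have "block_diagonal n 1 B = B 0"
    using base(1)[of 0] by (intro ext) (auto simp: block_diagonal_def mats_def)
  then show ?case using base(2)[of 0] by simp
next
  case (step k)
  have eq: "block_diagonal n (Suc k) B = direct_sum (k * n) (block_diagonal n k B) (B k)"
  proof (intro ext)
    fix p q
    have Bk: "B k i j = 0" if "\<not> (i < n \<and> j < n)" for i j
      using step.prems(1)[of k] that by (auto simp: mats_def)
    have div_lt: "r div n < k \<longleftrightarrow> r < k * n" for r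
      using n by (simp add: div_less_iff_less_mult)
    (* An index in the last block of size n. *)
    have last: "r div n = k \<and> r mod n = r - k * n" if "k * n \<le> r" "r < Suc k * n" for r
    proof -
      define t where "t = r - k * n"
      have r: "r = k * n + t" and t: "t < n" using that by (auto simp: t_def)
      have "(k * n + t) div n = k" "(k * n + t) mod n = t" using t by auto
      then show ?thesis by (simp add: r)
    qed
    consider "p < k * n" "q < k * n" | "p < k * n" "k * n \<le> q" | "k * n \<le> p" "q < k * n"
      | "k * n \<le> p" "k * n \<le> q" by linarith
    then show "block_diagonal n (Suc k) B p q = direct_sum (k * n) (block_diagonal n k B) (B k) p q"
    proof cases
      case 1
      then show ?thesis by (simp add: block_diagonal_def direct_sum_def)
    next
      case 2
      then have "p div n \<noteq> q div n" using div_lt[of p] div_lt[of q] by auto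
      with 2 show ?thesis by (simp add: block_diagonal_def direct_sum_def)
    next
      case 3
      then have "p div n \<noteq> q div n" using div_lt[of p] div_lt[of q] by auto
      with 3 show ?thesis by (simp add: block_diagonal_def direct_sum_def)
    next
      case 4
      show ?thesis
      proof (cases "p < Suc k * n \<and> q < Suc k * n")
        case True
        then show ?thesis
          using 4 last[of p] last[of q] by (simp add: block_diagonal_def direct_sum_def)
      next
        case False
        then have "\<not> (p - k * n < n \<and> q - k * n < n)" using 4 by auto
        then have "B k (p - k * n) (q - k * n) = 0" by (rule Bk)
        then show ?thesis using 4 False by (auto simp: block_diagonal_def direct_sum_def)
      qed
    qed
  qed
  have "mnrm V (k * n + n) (block_diagonal n (Suc k) B) = max (mnrm V (k * n) (block_diagonal n k B)) (mnrm V n (B k))"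
    unfolding eq using n step by (intro mnrm_direct_sum block_diagonal_mem) auto
  moreover have "mnrm V (k * n) (block_diagonal n k B) \<le> M" using step by auto
  moreover have "mnrm V n (B k) \<le> M" using step by auto
  ultimately show ?case by (simp add: add.commute)
qed

text \<open>A \<open>d \<times> d\<close> matrix is the sum of its \<open>d\<close> cyclically shifted diagonals
  \<open>j = i + s mod d\<close>. Up to a permutation of rows and columns each of them is block diagonal, so its
  norm is at most the largest norm of its blocks. The permutations also pass from the order in which
  \<open>(k, i)\<close> sits at place \<open>k d + i\<close> to the order with place \<open>i n + k\<close>.\<close>

theorem mnrm_le_dim_times_blocks:
  assumes n: "1 \<le> n" and d: "1 \<le> d" and B: "\<And>i j. i < d \<Longrightarrow> j < d \<Longrightarrow> B i j \<in> mats n (vecs V)"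
    and le: "\<And>i j. i < d \<Longrightarrow> j < d \<Longrightarrow> mnrm V n (B i j) \<le> M"
  defines "Z \<equiv> \<lambda>p q. if p < n * d \<and> q < n * d then B (p mod d) (q mod d) (p div d) (q div d) else 0"
  shows "Z \<in> mats (n * d) (vecs V)" "mnrm V (n * d) Z \<le> real d * M"
proof -
  have nd: "1 \<le> n * d" using n d by (metis mult_le_mono nat_mult_1)
  interpret M: complex_normed_space "Mat (n * d) V" by (rule Mat_normed[OF nd])
  define D where "D s = block_diagonal n d (\<lambda>i. B i ((i + s) mod d))" for s
  define f where "f p = (p mod d) * n + p div d" for p
  define g where "g s q = ((q mod d + (d - s)) mod d) * n + q div d" for s q
  define Zs where "Zs s = (\<lambda>p q. if p < n * d \<and> q < n * d \<and> q mod d = (p mod d + s) mod d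
    then B (p mod d) (q mod d) (p div d) (q div d) else 0)" for s
  have dpos: "0 < d" and npos: "0 < n" using d n by auto
  have divd: "p div d < n" if "p < n * d" for p using that by (simp add: less_mult_imp_div_less)
  have code: "(i * n + k) div n = i" "(i * n + k) mod n = k" if "k < n" for i k
    using that by auto
  have range: "i * n + k < n * d" if "k < n" "i < d" for i k
  proof -
    have "i * n + k < Suc i * n" using that by simp
    also have "\<dots> \<le> d * n" using that by (intro mult_le_mono1) simp
    finally show ?thesis by (simp add: mult.commute)
  qed
  (* For s < d the map i \<mapsto> i + s mod d is inverted by adding d - s, which avoids truncated subtraction. *)
  have shift: "i = (j + (d - s)) mod d \<longleftrightarrow> j = (i + s) mod d" if "i < d" "j < d" "s < d" for i j s
    using that by (cases "s \<le> j"; cases "i + s < d") (auto simp: mod_if)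
  have shift_lt: "(j + (d - s)) mod d < d" for j s using dpos by simp
  have D: "D s \<in> mats (n * d) (vecs V)" "mnrm V (n * d) (D s) \<le> M" for s
    using block_diagonal_mem[OF n, of d "\<lambda>i. B i ((i + s) mod d)"]
      mnrm_block_diagonal[OF n d, of "\<lambda>i. B i ((i + s) mod d)" M] B le dpos
    by (auto simp: D_def mult.commute)
  have f_code: "f p div n = p mod d" "f p mod n = p div d" if "p < n * d" for p
    unfolding f_def by (simp_all only: code divd[OF that])
  have g_code: "g s q div n = (q mod d + (d - s)) mod d" "g s q mod n = q div d" if "q < n * d" for s q
    unfolding g_def by (simp_all only: code divd[OF that])
  have Zs_eq: "Zs s = (\<lambda>p q. if p < n * d \<and> q < n * d \<and> f p < n * d \<and> g s q < n * d then D s (f p) (g s q) else 0)"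
    if s: "s < d" for s
  proof (intro ext)
    fix p q
    show "Zs s p q = (if p < n * d \<and> q < n * d \<and> f p < n * d \<and> g s q < n * d then D s (f p) (g s q) else 0)"
    proof (cases "p < n * d \<and> q < n * d")
      case True
      then have lt: "f p < n * d" "g s q < n * d"
        using dpos shift_lt divd by (auto simp: f_def g_def intro!: range)
      have sh: "p mod d = (q mod d + (d - s)) mod d \<longleftrightarrow> q mod d = (p mod d + s) mod d"
        using dpos s by (intro shift) auto
      show ?thesis
        using True lt by (auto simp: Zs_def D_def block_diagonal_def f_code g_code sh mult.commute[of d n])
    next
      case False
      then show ?thesis by (auto simp: Zs_def)
    qed
  qed
  have inj: "inj_on f {p. p < n * d \<and> f p < n * d}"
  proof (rule inj_onI)
    fix p p' assume p: "p \<in> {p. p < n * d \<and> f p < n * d}" "p' \<in> {p. p < n * d \<and> f p < n * d}" "f p = f p'"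
    then have "p mod d = p' mod d" "p div d = p' div d"
      using f_code[of p] f_code[of p'] by simp_all
    then show "p = p'" by (metis div_mult_mod_eq)
  qed
  have inj': "inj_on (g s) {p. p < n * d \<and> g s p < n * d}" if s: "s < d" for s
  proof (rule inj_onI)
    fix p p' assume p: "p \<in> {p. p < n * d \<and> g s p < n * d}" "p' \<in> {p. p < n * d \<and> g s p < n * d}" "g s p = g s p'"
    let ?h = "\<lambda>p. (p mod d + (d - s)) mod d"
    have "?h p = ?h p'" "p div d = p' div d"
      using p g_code[of p s] g_code[of p' s] by simp_all
    moreover have "p mod d = (?h p + s) mod d" "p' mod d = (?h p' + s) mod d"
      using shift[of "?h p" "p mod d" s] shift[of "?h p'" "p' mod d" s] dpos s by auto
    ultimately show "p = p'" by (metis div_mult_mod_eq)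
  qed
  have Zs_le: "mnrm V (n * d) (Zs s) \<le> M" if s: "s < d" for s
    unfolding Zs_eq[OF s] by (rule order_trans[OF mnrm_submatrix[OF nd nd D(1) inj inj'[OF s]] D(2)])
  have Zs_mem: "Zs s \<in> mats (n * d) (vecs V)" for s
    using mats_mem[OF B] zero_mem dpos by (auto simp: mats_def[of "n * d"] Zs_def)
  (* The entry (p, q) lies on exactly one cyclic diagonal, namely s = q - p mod d. *)
  have sum: "(\<Sum>s<d. Zs s) = Z"
  proof (intro ext)
    fix p q
    have "(\<Sum>s<d. Zs s p q) = (\<Sum>s<d. if s = (q mod d + (d - p mod d)) mod d then Z p q else 0)"
    proof (intro sum.cong refl)
      fix s assume "s \<in> {..<d}"
      then have "s = (q mod d + (d - p mod d)) mod d \<longleftrightarrow> q mod d = (s + p mod d) mod d"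
        using dpos by (intro shift) auto
      then show "Zs s p q = (if s = (q mod d + (d - p mod d)) mod d then Z p q else 0)"
        by (simp add: Zs_def Z_def add.commute)
    qed
    also have "\<dots> = Z p q" using dpos by simp
    finally show "(\<Sum>s<d. Zs s) p q = Z p q" by (simp add: sum_apply)
  qed
  show "Z \<in> mats (n * d) (vecs V)"
    using mats_mem[OF B] zero_mem dpos by (auto simp: mats_def[of "n * d"] Z_def)
  have "mnrm V (n * d) Z \<le> (\<Sum>s<d. mnrm V (n * d) (Zs s))"
    unfolding sum[symmetric] using M.nrm_sum[of "{..<d}" Zs] Zs_mem by simp
  also have "\<dots> \<le> (\<Sum>s<d. M)" using Zs_le by (intro sum_mono) simp
  finally show "mnrm V (n * d) Z \<le> real d * M" by simp
qed

subsection \<open>Matrices of vector measures\<close>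

definition unit_matrix :: "nat \<Rightarrow> nat \<Rightarrow> 'e \<Rightarrow> nat \<Rightarrow> nat \<Rightarrow> 'e" where
  "unit_matrix i j v = (\<lambda>k l. if k = i \<and> l = j then v else 0)"

lemma unit_matrix_mem: "i < n \<Longrightarrow> j < n \<Longrightarrow> v \<in> vecs V \<Longrightarrow> unit_matrix i j v \<in> mats n (vecs V)"
  using zero_mem by (auto simp: unit_matrix_def mats_def)

lemma mnrm_unit_matrix_le:
  assumes i: "i < n" and j: "j < n" and v: "v \<in> vecs V"
  shows "mnrm V n (unit_matrix i j v) \<le> nrm V v"
proof -
  let ?f = "\<lambda>i k. if k = i then 0 else 1 :: nat"
  have s: "single v \<in> mats 1 (vecs V)" using v by (auto simp: single_def mats_def)
  have "mnrm V n (\<lambda>k l. if k < n \<and> l < n \<and> ?f i k < 1 \<and> ?f j l < 1 then single v (?f i k) (?f j l) else 0)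
      \<le> mnrm V 1 (single v)"
    using i by (intro mnrm_submatrix s) (auto simp: inj_on_def split: if_splits)
  also have "(\<lambda>k l. if k < n \<and> l < n \<and> ?f i k < 1 \<and> ?f j l < 1 then single v (?f i k) (?f j l) else 0)
      = unit_matrix i j v"
    using i j by (intro ext) (auto simp: unit_matrix_def single_def)
  finally show ?thesis by (simp only: mnrm_single[OF v])
qed

lemma mats_eq_sum_unit_matrix:
  assumes x: "x \<in> mats n (vecs V)"
  shows "x = (\<Sum>i<n. \<Sum>j<n. unit_matrix i j (x i j))"
proof (intro ext)
  fix k l
  have "(\<Sum>i<n. \<Sum>j<n. unit_matrix i j (x i j) k l) = (\<Sum>i<n. if k = i then \<Sum>j<n. if l = j then x i j else 0 else 0)"
    by (intro sum.cong refl) (auto simp: unit_matrix_def)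
  also have "\<dots> = x k l" using x by (auto simp: mats_def)
  finally show "x k l = (\<Sum>i<n. \<Sum>j<n. unit_matrix i j (x i j)) k l"
    by (simp add: sum_apply)
qed

lemma mnrm_le_sum_entries:
  assumes n: "1 \<le> n" and x: "x \<in> mats n (vecs V)"
  shows "mnrm V n x \<le> (\<Sum>i<n. \<Sum>j<n. nrm V (x i j))"
proof -
  interpret M: complex_normed_space "Mat n V" by (rule Mat_normed[OF n])
  have mem: "unit_matrix i j (x i j) \<in> vecs (Mat n V)" if "i < n" "j < n" for i j
    using that by (simp add: unit_matrix_mem mats_mem[OF x])
  have "nrm (Mat n V) (\<Sum>i<n. \<Sum>j<n. unit_matrix i j (x i j))
      \<le> (\<Sum>i<n. nrm (Mat n V) (\<Sum>j<n. unit_matrix i j (x i j)))"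
    by (intro M.nrm_sum M.sum_mem mem) auto
  also have "\<dots> \<le> (\<Sum>i<n. \<Sum>j<n. nrm (Mat n V) (unit_matrix i j (x i j)))"
    by (intro sum_mono M.nrm_sum mem) auto
  also have "\<dots> \<le> (\<Sum>i<n. \<Sum>j<n. nrm V (x i j))"
    by (intro sum_mono) (simp add: mnrm_unit_matrix_le mats_mem[OF x])
  finally show ?thesis using mats_eq_sum_unit_matrix[OF x] by simp
qed

text \<open>Convergence in \<open>M\<^sub>n(V)\<close> follows from convergence of the entries, since the matrix norm is at
  most the sum of the norms of the entries.\<close>

lemma matrix_vector_measure:
  assumes n: "1 \<le> n" and N: "N \<in> mats n (vector_measures V)"
  shows "(\<lambda>A i j. N i j A) \<in> vector_measures (Mat n V)"
proof -
  have N': "N i j \<in> vector_measures V" if "i < n" "j < n" for i j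
    using N that by (simp add: mats_def)
  have N0: "N i j = 0" if "\<not> (i < n \<and> j < n)" for i j
    using N that by (simp add: mats_def)
  have mem: "(\<lambda>i j. N i j A) \<in> mats n (vecs V)" for A
    using N0 vector_measure_mem[OF N'] by (auto simp: mats_def)
  have off: "(\<lambda>i j. N i j A) = 0" if "A \<notin> sets borel" for A
  proof (intro ext)
    show "N i j A = 0 i j" for i j
      using N0[of i j] N'[of i j] that by (cases "i < n \<and> j < n") (auto simp: vector_measures_def)
  qed
  have "(\<lambda>m. mnrm V n ((\<Sum>i<m. (\<lambda>k l. N k l (A i))) - (\<lambda>k l. N k l (\<Union>i. A i)))) \<longlonglongrightarrow> 0"
    if A: "range A \<subseteq> sets borel" "disjoint_family A" for A :: "nat \<Rightarrow> _ set"
  proof -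
    interpret M: complex_normed_space "Mat n V" by (rule Mat_normed[OF n])
    define r where "r m = (\<Sum>i<m. (\<lambda>k l. N k l (A i))) - (\<lambda>k l. N k l (\<Union>i. A i))" for m
    have r: "r m \<in> mats n (vecs V)" for m
      using M.diff_mem[OF M.sum_mem, of "{..<m}" "\<lambda>i k l. N k l (A i)" "\<lambda>k l. N k l (\<Union>i. A i)"] mem
      by (simp add: r_def)
    have entry: "r m k l = (\<Sum>i<m. N k l (A i)) - N k l (\<Union>i. A i)" for m k l
      by (simp add: r_def fun_diff_def sum_apply)
    have "(\<lambda>m. \<Sum>k<n. \<Sum>l<n. nrm V (r m k l)) \<longlonglongrightarrow> (\<Sum>k<n. \<Sum>l<n. 0)"
      unfolding entry by (intro tendsto_sum vector_measure_sigma_additive[OF N' A]) auto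
    then have lim: "(\<lambda>m. \<Sum>k<n. \<Sum>l<n. nrm V (r m k l)) \<longlonglongrightarrow> 0" by simp
    have "norm (mnrm V n (r m)) \<le> (\<Sum>k<n. \<Sum>l<n. nrm V (r m k l))" for m
      using mnrm_le_sum_entries[OF n r] M.nrm_ge_0[of "r m"] r by simp
    then have "(\<lambda>m. mnrm V n (r m)) \<longlonglongrightarrow> 0"
      by (intro Lim_null_comparison[OF always_eventually lim] allI)
    then show ?thesis by (simp only: r_def)
  qed
  then show ?thesis using mem off unfolding vector_measures_def by simp
qed

text \<open>Composing a functional on \<open>M\<^sub>n(V)\<close> with the embedding of \<open>V\<close> as the entry \<open>(i, j)\<close> gives a
  bounded functional on \<open>V\<close>, and the functional is the sum of these applied to the entries.\<close>

lemma matrix_weak_integral: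
  assumes n: "1 \<le> n" and N: "N \<in> mats n (vector_measures V)" and f: "bounded_borel f"
    and x: "x \<in> mats n (vecs V)" and xij: "\<And>i j. i < n \<Longrightarrow> j < n \<Longrightarrow> weak_integral V (N i j) f (x i j)"
  shows "weak_integral (Mat n V) (\<lambda>A i j. N i j A) f x"
proof -
  interpret M: complex_normed_space "Mat n V" by (rule Mat_normed[OF n])
  have N': "N i j \<in> vector_measures V" if "i < n" "j < n" for i j
    using N that by (simp add: mats_def)
  have NA: "(\<lambda>i j. N i j A) \<in> mats n (vecs V)" for A
    using M.vector_measure_mem[OF matrix_vector_measure[OF n N]] by simp
  have "\<phi> x = complex_measure_integral (\<lambda>A. \<phi> (\<lambda>i j. N i j A)) f" if \<phi>: "\<phi> \<in> dual (Mat n V)" for \<phi>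
  proof -
    define \<psi> where "\<psi> i j v = \<phi> (unit_matrix i j v)" for i j v
    obtain K where K: "0 \<le> K" "\<And>y. y \<in> mats n (vecs V) \<Longrightarrow> cmod (\<phi> y) \<le> K * mnrm V n y"
      using M.dual_bound[OF \<phi>] by auto
    have \<psi>: "\<psi> i j \<in> dual V" if ij: "i < n" "j < n" for i j
    proof (rule dualI)
      show "linear_map V scalar_field (\<psi> i j)"
        unfolding linear_map_def
      proof (intro conjI ballI allI)
        fix v w assume v: "v \<in> vecs V" and w: "w \<in> vecs V"
        have "unit_matrix i j (v + w) = unit_matrix i j v + unit_matrix i j w"
          by (intro ext) (simp add: unit_matrix_def)
        then show "\<psi> i j (v + w) = \<psi> i j v + \<psi> i j w"
          using M.dual_add[OF \<phi>] unit_matrix_mem[OF ij] v w by (simp add: \<psi>_def)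
      next
        fix a v assume v: "v \<in> vecs V"
        have "unit_matrix i j (scal V a v) = scal (Mat n V) a (unit_matrix i j v)"
          by (intro ext) (simp add: unit_matrix_def scal_zero_right)
        then show "\<psi> i j (scal V a v) = scal scalar_field a (\<psi> i j v)"
          using M.dual_scal[OF \<phi>] unit_matrix_mem[OF ij v] by (simp add: \<psi>_def)
      qed simp
      show "cmod (\<psi> i j v) \<le> K * nrm V v" if v: "v \<in> vecs V" for v
        using K(2)[OF unit_matrix_mem[OF ij v]] mult_left_mono[OF mnrm_unit_matrix_le[OF ij v] K(1)]
        by (simp add: \<psi>_def)
    qed
    have split: "\<phi> y = (\<Sum>(i, j)\<in>{..<n} \<times> {..<n}. \<psi> i j (y i j))" if y: "y \<in> mats n (vecs V)" for y
    proof -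
      have "\<phi> y = \<phi> (\<Sum>(i, j)\<in>{..<n} \<times> {..<n}. unit_matrix i j (y i j))"
        using mats_eq_sum_unit_matrix[OF y] by (simp add: sum.cartesian_product)
      also have "\<dots> = (\<Sum>(i, j)\<in>{..<n} \<times> {..<n}. \<psi> i j (y i j))"
        by (subst M.dual_sum[OF \<phi>])
          (auto simp: \<psi>_def unit_matrix_mem mats_mem[OF y] intro!: sum.cong)
      finally show ?thesis .
    qed
    have "\<phi> x = (\<Sum>p\<in>{..<n} \<times> {..<n}. \<psi> (fst p) (snd p) (x (fst p) (snd p)))"
      by (simp add: split[OF x] case_prod_unfold)
    also have "\<dots> = (\<Sum>p\<in>{..<n} \<times> {..<n}.
        complex_measure_integral (\<lambda>A. \<psi> (fst p) (snd p) (N (fst p) (snd p) A)) f)"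
      using xij \<psi> by (intro sum.cong refl) (auto simp: weak_integral_def)
    also have "\<dots> = complex_measure_integral (\<lambda>A. \<Sum>p\<in>{..<n} \<times> {..<n}. \<psi> (fst p) (snd p) (N (fst p) (snd p) A)) f"
      using dual_compose_vector_measure[OF \<psi> N']
      by (intro complex_measure_integral_sum[OF f, THEN conjunct2, symmetric]) auto
    finally show ?thesis by (simp add: split[OF NA] case_prod_unfold)
  qed
  then show ?thesis using x by (simp add: weak_integral_def)
qed

end

section \<open>Unitary representations\<close>

lemma mat_adjoint_entry:
  "i < dim_col A \<Longrightarrow> j < dim_row A \<Longrightarrow> mat_adjoint A $$ (i, j) = cnj (A $$ (j, i))" for A :: "complex mat"
  by (simp add: mat_adjoint_def mat_of_rows_index)

text \<open>The rows of a unitary matrix are unit vectors.\<close>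

lemma unitary_mat_entry_le_1:
  assumes U: "unitary_mat d U" and i: "i < d" and j: "j < d"
  shows "cmod (U $$ (i, j)) \<le> 1"
proof -
  have dim: "dim_row U = d" "dim_col U = d" and inv: "U * mat_adjoint U = 1\<^sub>m d"
    using U by (auto simp: unitary_mat_def)
  have adj: "dim_row (mat_adjoint U) = d" "dim_col (mat_adjoint U) = d"
    using dim by (simp_all add: mat_adjoint_def)
  have "(U * mat_adjoint U) $$ (i, i) = (\<Sum>k<d. U $$ (i, k) * mat_adjoint U $$ (k, i))"
    using i dim adj by (simp add: scalar_prod_def atLeast0LessThan)
  also have "\<dots> = (\<Sum>k<d. of_real ((cmod (U $$ (i, k)))\<^sup>2))"
    using i dim by (intro sum.cong refl) (simp add: mat_adjoint_entry complex_norm_square del: of_real_power)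
  finally have "of_real (\<Sum>k<d. (cmod (U $$ (i, k)))\<^sup>2) = (1 :: complex)"
    using i by (simp add: inv)
  then have "(\<Sum>k<d. (cmod (U $$ (i, k)))\<^sup>2) = 1"
    using of_real_eq_1_iff by blast
  moreover have "(cmod (U $$ (i, j)))\<^sup>2 \<le> (\<Sum>k<d. (cmod (U $$ (i, k)))\<^sup>2)"
    using j by (intro member_le_sum) auto
  ultimately show ?thesis by (simp add: power2_nonneg_ge_1_iff abs_square_le_1)
qed

lemma irreps_dim_pos: "\<pi> \<in> irreps \<Longrightarrow> 1 \<le> rep_dim \<pi>"
  and irreps_unitary: "\<pi> \<in> irreps \<Longrightarrow> unitary_rep (rep_dim \<pi>) \<pi>"
proof -
  assume "\<pi> \<in> irreps"
  then obtain d where d: "irreducible_rep d \<pi>" by (auto simp: irreps_def)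
  then have "\<pi> 0 \<in> carrier_mat d d"
    by (auto simp: irreducible_rep_def unitary_rep_def unitary_mat_def)
  then have "rep_dim \<pi> = d" by (simp add: rep_dim_def)
  then show "1 \<le> rep_dim \<pi>" "unitary_rep (rep_dim \<pi>) \<pi>"
    using d by (auto simp: irreducible_rep_def)
qed

lemma irreps_coefficient:
  assumes \<pi>: "\<pi> \<in> irreps" and ij: "i < rep_dim \<pi>" "j < rep_dim \<pi>"
  shows "(\<lambda>t. cnj (\<pi> t $$ (i, j))) \<in> borel_measurable borel" "cmod (cnj (\<pi> t $$ (i, j))) \<le> 1"
    "bounded_borel (\<lambda>t. cnj (\<pi> t $$ (i, j)))"
proof -
  have "continuous_on UNIV (\<lambda>t. \<pi> t $$ (i, j))"
    using irreps_unitary[OF \<pi>] ij by (simp add: unitary_rep_def)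
  then show meas: "(\<lambda>t. cnj (\<pi> t $$ (i, j))) \<in> borel_measurable borel"
    by (intro borel_measurable_continuous_onI continuous_on_cnj)
  have le: "cmod (cnj (\<pi> t $$ (i, j))) \<le> 1" for t
    using irreps_unitary[OF \<pi>] ij unitary_mat_entry_le_1[of "rep_dim \<pi>" "\<pi> t" i j]
    by (simp add: unitary_rep_def)
  then show "cmod (cnj (\<pi> t $$ (i, j))) \<le> 1" .
  show "bounded_borel (\<lambda>t. cnj (\<pi> t $$ (i, j)))"
    by (rule bounded_borelI[OF meas le])
qed

lemma dual_group_representative: "c \<in> dual_group \<Longrightarrow> \<pi> \<in> c \<Longrightarrow> \<pi> \<in> irreps"
  unfolding dual_group_def rep_equiv_def by (auto elim!: quotientE)

text \<open>The trivial representation gives a class. Without this, the suprema over the dual group would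
  be suprema of the empty set of reals, about which nothing can be said.\<close>

lemma dual_group_nonempty: "(dual_group :: ('g::topological_group_add \<Rightarrow> complex mat) set set) \<noteq> {}"
proof -
  let ?\<pi> = "\<lambda>t :: 'g. 1\<^sub>m 1 :: complex mat"
  have "mat_adjoint (1\<^sub>m 1) = (1\<^sub>m 1 :: complex mat)"
    by (rule eq_matI) (auto simp: mat_adjoint_entry, auto simp: mat_adjoint_def)
  then have unitary: "unitary_rep 1 ?\<pi>" by (simp add: unitary_rep_def unitary_mat_def)
  have trivial: "W = {0\<^sub>v 1} \<or> W = carrier_vec 1"
    if W: "subspace class_ring W (module_vec TYPE(complex) 1)" for W
  proof (cases "W \<subseteq> {0\<^sub>v 1}")
    case True
    have "0\<^sub>v 1 \<in> W"
      using W submodule.zero_closed[of class_ring W "module_vec TYPE(complex) 1"]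
      by (simp add: subspace_def module_vec_simps)
    then show ?thesis using True by blast
  next
    case False
    have sub: "W \<subseteq> carrier_vec 1" and smult: "\<And>a w. w \<in> W \<Longrightarrow> a \<cdot>\<^sub>v w \<in> W"
      using W submodule.subset[of class_ring W "module_vec TYPE(complex) 1"]
        submodule.smult_closed[of class_ring W "module_vec TYPE(complex) 1"]
      by (auto simp: subspace_def module_vec_simps class_ring_simps)
    obtain w where w: "w \<in> W" "w \<noteq> 0\<^sub>v 1" using False by blast
    then have wc: "w \<in> carrier_vec 1" and w0: "w $ 0 \<noteq> 0"
      using sub by (auto simp: vec_eq_iff)
    have "v \<in> W" if v: "v \<in> carrier_vec 1" for v
    proof -
      have "v = (v $ 0 / w $ 0) \<cdot>\<^sub>v w" using v wc w0 by (intro eq_vecI) auto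
      then show ?thesis using smult[OF w(1)] by metis
    qed
    then show ?thesis using sub by blast
  qed
  have "0 < (1 :: nat)" by simp
  then have "irreducible_rep 1 ?\<pi>"
    unfolding irreducible_rep_def using unitary trivial by blast
  then have "?\<pi> \<in> irreps" by (auto simp only: irreps_def)
  then show ?thesis unfolding dual_group_def quotient_def by auto
qed

section \<open>The Fourier transform\<close>

context operator_space
begin

text \<open>The matrix coefficients of \<open>\<pi>\<close> have modulus at most \<open>1\<close>, so \<open>S\<close> bounds each of the
  \<open>d \<times> d\<close> blocks of integrals in \<open>M\<^sub>n(V)\<close>. The cyclic diagonals cost a factor \<open>d\<close>, which the
  normalisation \<open>1 / d\<close> of the Fourier coefficients cancels. The bound \<open>S\<close> is kept abstract because
  it is the semivariation of \<open>\<nu>\<close> itself in the scalar case, and that of the associated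
  \<open>M\<^sub>n(V)\<close>-valued measure in the matrix case.\<close>

lemma mnrm_fourier_coeff_le:
  assumes complete: "complete_space V" and \<pi>: "\<pi> \<in> irreps" and n: "1 \<le> n"
    and N: "\<And>k l. k < n \<Longrightarrow> l < n \<Longrightarrow> N k l \<in> vector_measures V"
    and le: "\<And>f x. f \<in> borel_measurable borel \<Longrightarrow> (\<And>t. cmod (f t) \<le> 1) \<Longrightarrow> x \<in> mats n (vecs V) \<Longrightarrow>
      (\<And>k l. k < n \<Longrightarrow> l < n \<Longrightarrow> weak_integral V (N k l) f (x k l)) \<Longrightarrow> mnrm V n x \<le> S"
  defines "d \<equiv> rep_dim \<pi>"
  defines "Z \<equiv> \<lambda>p q. if p < n * d \<and> q < n * d
    then fourier_coeff V \<pi> (N (p div d) (q div d)) (p mod d) (q mod d) else 0"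
  shows "Z \<in> mats (n * d) (vecs V)" "mnrm V (n * d) Z \<le> S"
proof -
  have d: "1 \<le> d" unfolding d_def by (rule irreps_dim_pos[OF \<pi>])
  then have nd: "1 \<le> n * d" using n by (metis mult_le_mono nat_mult_1)
  interpret M: complex_normed_space "Mat (n * d) V" by (rule Mat_normed[OF nd])
  define B where "B i j = (\<lambda>k l. if k < n \<and> l < n then vector_integral V (N k l) (\<lambda>t. cnj (\<pi> t $$ (j, i))) else 0)" for i j
  define Z' where "Z' = (\<lambda>p q. if p < n * d \<and> q < n * d then B (p mod d) (q mod d) (p div d) (q div d) else 0)"
  have wi: "weak_integral V (N k l) (\<lambda>t. cnj (\<pi> t $$ (j, i))) (B i j k l)"
    if "i < d" "j < d" "k < n" "l < n" for i j k l
    using that weak_integral_vector_integral[OF complete N irreps_coefficient(3)[OF \<pi>]] by (simp add: B_def d_def)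
  have B: "B i j \<in> mats n (vecs V)" if "i < d" "j < d" for i j
    using weak_integral_mem[OF wi[OF that]] by (auto simp: mats_def B_def)
  have B_le: "mnrm V n (B i j) \<le> S" if ij: "i < d" "j < d" for i j
    using irreps_coefficient[OF \<pi>] ij unfolding d_def by (intro le[OF _ _ B wi]) (auto simp: d_def)
  have blocks: "Z' \<in> mats (n * d) (vecs V)" "mnrm V (n * d) Z' \<le> real d * S"
    unfolding Z'_def by (rule mnrm_le_dim_times_blocks[where B = B and M = S, OF n d B B_le]; assumption)+
  have Z: "Z = scal (Mat (n * d) V) (1 / of_nat d) Z'"
  proof (intro ext)
    fix p q
    have "p mod d < d" "q mod d < d" using d by auto
    then show "Z p q = scal (Mat (n * d) V) (1 / of_nat d) Z' p q"
      by (auto simp: Z_def Z'_def B_def fourier_coeff_def d_def[symmetric] scal_zero_right less_mult_imp_div_less)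
  qed
  show "Z \<in> mats (n * d) (vecs V)"
    using M.scal_mem[of Z' "1 / of_nat d"] blocks(1) unfolding Z by simp
  have "mnrm V (n * d) Z = mnrm V (n * d) Z' / real d"
    using M.nrm_scal[of Z' "1 / of_nat d"] blocks(1) unfolding Z by (simp add: norm_divide)
  then have "real d * mnrm V (n * d) Z \<le> real d * S" using blocks(2) d by simp
  then show "mnrm V (n * d) Z \<le> S" using d by simp
qed

lemma fourier_coeff_bound:
  assumes complete: "complete_space V" and \<pi>: "\<pi> \<in> irreps" and \<nu>: "\<nu> \<in> vector_measures V"
  shows "fourier_coeff V \<pi> \<nu> \<in> mats (rep_dim \<pi>) (vecs V)"
    "mnrm V (rep_dim \<pi>) (fourier_coeff V \<pi> \<nu>) \<le> enn2real (semivariation V \<nu>)"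
proof -
  let ?Z = "\<lambda>p q. if p < 1 * rep_dim \<pi> \<and> q < 1 * rep_dim \<pi>
    then fourier_coeff V \<pi> \<nu> (p mod rep_dim \<pi>) (q mod rep_dim \<pi>) else 0"
  have le: "mnrm V 1 x \<le> enn2real (semivariation V \<nu>)"
    if f: "f \<in> borel_measurable borel" "\<And>t. cmod (f t) \<le> 1" and x: "x \<in> mats 1 (vecs V)"
      and wi: "\<And>k l. k < 1 \<Longrightarrow> l < 1 \<Longrightarrow> weak_integral V \<nu> f (x k l)" for f x
  proof -
    have "x = single (x 0 0)" using x by (intro ext) (auto simp: mats_def single_def)
    then have "mnrm V 1 x = nrm V (x 0 0)" using mnrm_single[OF mats_mem[OF x]] by metis
    also have "\<dots> \<le> 1 * enn2real (semivariation V \<nu>)"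
      by (rule nrm_weak_integral_le[OF \<nu> f wi]) simp_all
    finally show ?thesis by simp
  qed
  have Z: "?Z = fourier_coeff V \<pi> \<nu>"
    by (intro ext) (auto simp: fourier_coeff_def)
  have "?Z \<in> mats (1 * rep_dim \<pi>) (vecs V)"
    by (rule mnrm_fourier_coeff_le(1)[OF complete \<pi> order_refl \<nu> le])
  then show "fourier_coeff V \<pi> \<nu> \<in> mats (rep_dim \<pi>) (vecs V)" unfolding Z by (simp only: mult_1)
  have "mnrm V (1 * rep_dim \<pi>) ?Z \<le> enn2real (semivariation V \<nu>)"
    by (rule mnrm_fourier_coeff_le(2)[OF complete \<pi> order_refl \<nu> le])
  then show "mnrm V (rep_dim \<pi>) (fourier_coeff V \<pi> \<nu>) \<le> enn2real (semivariation V \<nu>)"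
    unfolding Z by (simp only: mult_1)
qed

lemma fourier_coeff_matrix_bound:
  assumes complete: "complete_space V" and \<pi>: "\<pi> \<in> irreps" and n: "1 \<le> n"
    and N: "N \<in> mats n (vector_measures V)"
  defines "d \<equiv> rep_dim \<pi>"
  shows "mnrm V (n * d) (\<lambda>p q. if p < n * d \<and> q < n * d
      then fourier_coeff V \<pi> (N (p div d) (q div d)) (p mod d) (q mod d) else 0)
    \<le> enn2real (semivariation (Mat n V) (\<lambda>A i j. N i j A))"
  unfolding d_def
proof (rule mnrm_fourier_coeff_le(2)[OF complete \<pi> n])
  interpret M: complex_normed_space "Mat n V" by (rule Mat_normed[OF n])
  show "N k l \<in> vector_measures V" if "k < n" "l < n" for k l
    using N that by (simp add: mats_def)
  fix f x
  assume f: "f \<in> borel_measurable borel" "\<And>t. cmod (f t) \<le> 1" and x: "x \<in> mats n (vecs V)"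
    and wi: "\<And>k l. k < n \<Longrightarrow> l < n \<Longrightarrow> weak_integral V (N k l) f (x k l)"
  have "weak_integral (Mat n V) (\<lambda>A i j. N i j A) f x"
    by (rule matrix_weak_integral[OF n N bounded_borelI[OF f] x wi])
  then have "nrm (Mat n V) x \<le> 1 * enn2real (semivariation (Mat n V) (\<lambda>A i j. N i j A))"
    by (rule M.nrm_weak_integral_le[OF matrix_vector_measure[OF n N] f])
  then show "mnrm V n x \<le> enn2real (semivariation (Mat n V) (\<lambda>A i j. N i j A))" by simp
qed

lemma fourier_coeff_add:
  assumes complete: "complete_space V" and \<pi>: "\<pi> \<in> irreps"
    and \<nu>1: "\<nu>1 \<in> vector_measures V" and \<nu>2: "\<nu>2 \<in> vector_measures V"
  shows "fourier_coeff V \<pi> (\<nu>1 + \<nu>2) = fourier_coeff V \<pi> \<nu>1 + fourier_coeff V \<pi> \<nu>2"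
proof (intro ext)
  fix i j
  have "vector_integral V (\<nu>1 + \<nu>2) f = vector_integral V \<nu>1 f + vector_integral V \<nu>2 f"
    "vector_integral V \<nu>1 f \<in> vecs V" "vector_integral V \<nu>2 f \<in> vecs V" if f: "bounded_borel f" for f
  proof -
    note int1 = weak_integral_vector_integral[OF complete \<nu>1 f]
      and int2 = weak_integral_vector_integral[OF complete \<nu>2 f]
    show "vector_integral V (\<nu>1 + \<nu>2) f = vector_integral V \<nu>1 f + vector_integral V \<nu>2 f"
      using vector_integral_eq[OF weak_integral_add_measure[OF \<nu>1 \<nu>2 f int1 int2]] by (simp add: plus_fun_def)
    show "vector_integral V \<nu>1 f \<in> vecs V" "vector_integral V \<nu>2 f \<in> vecs V"
      by (rule weak_integral_mem[OF int1], rule weak_integral_mem[OF int2])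
  qed
  then show "fourier_coeff V \<pi> (\<nu>1 + \<nu>2) i j = (fourier_coeff V \<pi> \<nu>1 + fourier_coeff V \<pi> \<nu>2) i j"
    using irreps_coefficient(3)[OF \<pi>] by (simp add: fourier_coeff_def scal_add_right)
qed

lemma fourier_coeff_scal:
  assumes complete: "complete_space V" and \<pi>: "\<pi> \<in> irreps" and \<nu>: "\<nu> \<in> vector_measures V"
  shows "fourier_coeff V \<pi> (\<lambda>A. scal V a (\<nu> A)) = (\<lambda>i j. scal V a (fourier_coeff V \<pi> \<nu> i j))"
proof (intro ext)
  fix i j
  have "vector_integral V (\<lambda>A. scal V a (\<nu> A)) f = scal V a (vector_integral V \<nu> f)"
    "vector_integral V \<nu> f \<in> vecs V" if f: "bounded_borel f" for f
  proof -
    note int = weak_integral_vector_integral[OF complete \<nu> f]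
    show "vector_integral V (\<lambda>A. scal V a (\<nu> A)) f = scal V a (vector_integral V \<nu> f)"
      by (rule vector_integral_eq[OF weak_integral_scal_measure[OF \<nu> f int]])
    show "vector_integral V \<nu> f \<in> vecs V" by (rule weak_integral_mem[OF int])
  qed
  then show "fourier_coeff V \<pi> (\<lambda>A. scal V a (\<nu> A)) i j = scal V a (fourier_coeff V \<pi> \<nu> i j)"
    using irreps_coefficient(3)[OF \<pi>]
    by (simp add: fourier_coeff_def scal_scal scal_zero_right mult.commute)
qed

end

theorem theorem7p4:
  fixes X :: "('x::ab_group_add) mnormed"
    and \<rho> :: "('g::{topological_group_add, t2_space} \<Rightarrow> complex mat) set \<Rightarrow> ('g \<Rightarrow> complex mat)"
  assumes compact_group: "compact (UNIV :: 'g set)"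
    and operator_space: "operator_space X"
    and complete: "complete_space X"
    and representatives: "\<forall>c\<in>dual_group. \<rho> c \<in> c"
  shows "(\<forall>\<nu>\<in>vector_measures X.
            fourier X \<rho> \<nu> \<in> vecs (fourier_target X \<rho>) \<and>
            (SUP c\<in>dual_group. mnrm X (rep_dim (\<rho> c)) (fourier X \<rho> \<nu> c)) \<le> nrm (measure_space_os X) \<nu>)
       \<and> completely_bounded (measure_space_os X) (fourier_target X \<rho>) (fourier X \<rho>)"
proof -
  interpret operator_space X by (rule operator_space)
  have irrep: "\<rho> c \<in> irreps" if "c \<in> dual_group" for c
    using dual_group_representative[OF that] representatives that by blast
  have coeff: "fourier X \<rho> \<nu> c \<in> mats (rep_dim (\<rho> c)) (vecs X)"
    "mnrm X (rep_dim (\<rho> c)) (fourier X \<rho> \<nu> c) \<le> nrm (measure_space_os X) \<nu>"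
    if "\<nu> \<in> vector_measures X" "c \<in> dual_group" for \<nu> c
    using that fourier_coeff_bound[OF complete irrep] by (simp_all add: fourier_def measure_space_os_def)
  have target: "fourier X \<rho> \<nu> \<in> vecs (fourier_target X \<rho>)" if \<nu>: "\<nu> \<in> vector_measures X" for \<nu>
    using coeff[OF \<nu>]
    by (auto simp: fourier_target_def linf_sum_def Mat_os_def fourier_def intro!: bdd_aboveI2)
  have sup: "(SUP c\<in>dual_group. mnrm X (rep_dim (\<rho> c)) (fourier X \<rho> \<nu> c)) \<le> nrm (measure_space_os X) \<nu>"
    if \<nu>: "\<nu> \<in> vector_measures X" for \<nu>
    using coeff(2)[OF \<nu>] by (intro cSUP_least dual_group_nonempty)
  have lin: "linear_map (measure_space_os X) (fourier_target X \<rho>) (fourier X \<rho>)"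
    unfolding linear_map_def
  proof (intro conjI ballI allI)
    fix \<nu> :: "'g set \<Rightarrow> 'x" assume "\<nu> \<in> vecs (measure_space_os X)"
    then have \<nu>: "\<nu> \<in> vector_measures X" by (simp add: measure_space_os_def)
    show "fourier X \<rho> \<nu> \<in> vecs (fourier_target X \<rho>)" by (rule target[OF \<nu>])
    show "fourier X \<rho> (\<nu> + \<nu>') = fourier X \<rho> \<nu> + fourier X \<rho> \<nu>'" if "\<nu>' \<in> vecs (measure_space_os X)" for \<nu>'
      using fourier_coeff_add[OF complete irrep \<nu>] that
      by (intro ext) (simp add: fourier_def measure_space_os_def)
    show "fourier X \<rho> (scal (measure_space_os X) a \<nu>) = scal (fourier_target X \<rho>) a (fourier X \<rho> \<nu>)" for a
    proof -
      have "scal (measure_space_os X) a \<nu> = (\<lambda>A. scal X a (\<nu> A))"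
        using \<nu> by (auto simp: measure_space_os_def vector_measures_def scal_zero_right)
      then show ?thesis
        using fourier_coeff_scal[OF complete irrep \<nu>]
        by (intro ext) (simp add: fourier_def fourier_target_def linf_sum_def Mat_os_def)
    qed
  qed
  have amp: "op_norm (Mat n (measure_space_os X)) (Mat n (fourier_target X \<rho>)) (amplification n (fourier X \<rho>)) \<le> 1"
    if n: "1 \<le> n" for n
    unfolding op_norm_def
  proof (rule SUP_least)
    fix N :: "nat \<Rightarrow> nat \<Rightarrow> 'g set \<Rightarrow> 'x"
    assume "N \<in> {N \<in> vecs (Mat n (measure_space_os X)). nrm (Mat n (measure_space_os X)) N \<le> 1}"
    then have N: "N \<in> mats n (vector_measures X)"
      and le: "enn2real (semivariation (Mat n X) (\<lambda>A i j. N i j A)) \<le> 1"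
      by (auto simp: Mat_def measure_space_os_def)
    have bound: "mnrm (Mat_os (rep_dim (\<rho> c)) X) n (\<lambda>k l. amplification n (fourier X \<rho>) N k l c) \<le> 1"
      if c: "c \<in> dual_group" for c
    proof -
      let ?d = "rep_dim (\<rho> c)"
      have pos: "0 < ?d" using irreps_dim_pos[OF irrep[OF c]] by simp
      have "(\<lambda>p q. amplification n (fourier X \<rho>) N (p div ?d) (q div ?d) c (p mod ?d) (q mod ?d)) =
        (\<lambda>p q. if p < n * ?d \<and> q < n * ?d
          then fourier_coeff X (\<rho> c) (N (p div ?d) (q div ?d)) (p mod ?d) (q mod ?d) else 0)"
        using c pos by (intro ext) (simp add: amplification_def fourier_def div_less_iff_less_mult)
      then show ?thesis
        using fourier_coeff_matrix_bound[OF complete irrep[OF c] n N] le by (simp add: Mat_os_def)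
    qed
    have "nrm (Mat n (fourier_target X \<rho>)) (amplification n (fourier X \<rho>) N) \<le> 1"
      using bound by (simp add: Mat_def fourier_target_def linf_sum_def cSUP_least[OF dual_group_nonempty])
    then show "ennreal (nrm (Mat n (fourier_target X \<rho>)) (amplification n (fourier X \<rho>) N)) \<le> 1"
      by (simp add: ennreal_le_1)
  qed
  have "(SUP n\<in>{1..}. op_norm (Mat n (measure_space_os X)) (Mat n (fourier_target X \<rho>))
      (amplification n (fourier X \<rho>))) \<le> 1"
    using amp by (intro SUP_least) auto
  also have "(1 :: ennreal) < \<infinity>" by simp
  finally have "completely_bounded (measure_space_os X) (fourier_target X \<rho>) (fourier X \<rho>)"
    using lin by (simp add: completely_bounded_def)
  then show ?thesis using target sup by blast
qed

end
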